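(* Let $\mathcal{A}$ be a finite-dimensional descendingly flexible algebra over an arbitrary field $\mathbb{F}$, let $S \subseteq \mathcal{A}$, and let $w \in S^{(m)}$ for some $m \geq 3$. Then: (1) The word $w$ is equivalent to $\pm (xy)z$ or $\pm z'(y'x')$, where $x, y', z'$ are left swapping words, and $x', y, z$ are right swapping words. (2) The word $(xy)z$ or $z'(y'x')$ is obtained from $w$ by a permutation of letters, and this permutation preserves the classes of pairwise swappable letters in these words. (3) The word $(xy)z$ or $z'(y'x')$ can be chosen in such a way that one of the following conditions holds (here $l(x)$ denotes the length of either $x$ or $x'$, and similarly for $l(y)$ and $l(z)$): - (EOO) $l(x)$ is even, $l(y)$, $l(z)$ are odd; - (OEE) $l(x)$ is odd, $l(y)$, $l(z)$ are even; - (O11) $l(x)$ is odd, $l(y)=l(z)=1$; - (OO) $l(x)=1$, $l(y)$ is even, $l(z)$ is odd, i.e. $w\sim\pm uv$, where $u=xy$ (or $u=z'$) is left swapping of odd length, $v=z$ (or $v=y'x'$) is right swapping of odd length, and at least one of $l(u)$, $l(v)$ is greater than $1$; - (OE) $l(x)$, $l(y)$ are odd with $l(y)\ge3$, and $l(z)=1$, i.e. either $w\sim\pm(xy)z\sim\mp(zy)x=\mp uv$, where $u=zy$ is left swapping of even length with $l(u)\ge4$ and $v=x$ is left swapping of odd length; or, symmetrically, $w\sim\pm z'(y'x')\sim\mp x'(y'z')=\mp v'u'$, where $u'=y'z'$ is right swapping of even length with $l(u')\ge4$ and $v'=x'$ is right swapping of odd length. (4) There are at most three classes of pairwise swappable letters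 in $w$. Namely, in cases (EOO), (OEE), (O11) the letters of $(xy)z$ or $z'(y'x')$ can be divided into three types I, II, III such that all letters of each type are pairwise swappable (i.e. each type is contained in a single class of pairwise swappable letters), as follows. In cases (EOO) and (O11): type I consists of the inner letter of $x$ (resp. $x'$) and the outer letters (if any) of $z$ (resp. $z'$); type II consists of the inner letter of $y$ (resp. $y'$) and the outer letters (if any) of $x$ (resp. $x'$); type III consists of the inner letter of $z$ (resp. $z'$) and the outer letters (if any) of $y$ (resp. $y'$). In case (OEE): type I consists of the inner letter of $x$ (resp. $x'$) and the outer letters of $y$ (resp. $y'$); type II consists of the inner letter of $y$ (resp. $y'$) and the outer letters of $z$ (resp. $z'$); type III consists of the inner letter of $z$ (resp. $z'$) and the outer letters (if any) of $x$ (resp. $x'$). In cases (OO) and (OE) it is sufficient to use only two types: type I consists of the outer letters (if any) of $u$ (resp. $u'$) and the inner letter of $v$ (resp. $v'$); type II consists of the inner letter of $u$ (resp. $u'$) and the outer letters (if any) of $v$ (resp. $v'$). (5) The largest class of pairwise swappable letters contains at least $\lfloor m/3\rfloor+1$ elements.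
   Context: $\mathcal{A}$ is possibly non-unital and non-associative. If $\mathcal{A}$ is unital, its unity is denoted by $e$. For $a,b,c\in\mathcal{A}$ let $\mathcal{L}'_2(a,b,c)$ be the span of $a,b,c,ab,ba,cb,bc,ac,ca$ (together with $e$ if $\mathcal{A}$ is unital), and let $\mathcal{L}_1(a,b,aa,ab,ba)$ be the span of $a,b,aa,ab,ba$ (together with $e$ if $\mathcal{A}$ is unital). $\mathcal{A}$ is descendingly flexible if for all $a,b,c\in\mathcal{A}$: $(ab)a,\ a(ba) \in \mathcal{L}_1(a,b,aa,ab,ba)$; $(ab)c+(cb)a\in\mathcal{L}'_2(a,b,c)$; and $a(bc)+c(ba)\in\mathcal{L}'_2(a,b,c)$. Words. A word of length $k\ge1$ in $S$ is a product of $k$ elements (letters) of $S$ with some arrangement of brackets; $e$ is a word of length $0$ if $\mathcal{A}$ is unital, otherwise there are no words of length $0$. Words are regarded as bracketed expressions, also identified with their values in $\mathcal{A}$; the length $l(x)$ of a word $x$ is the number of letters in its notation, and letters in a word are regarded as occurrences. $S^k$ is the set of words of length at most $k$, $S^\infty=\bigcup_k S^k$, $\pm S^\infty$ is the set of words with a sign $+$ or $-$ (with the same lengths), and $\mathcal{L}_k(S)$ is the linear span of $S^k$. $L_a(x)=ax$ and $R_a(x)=xa$. $S^{(m)}$ is defined by $S^{(1)}=S$, $S^{(k+1)}=S^{(k)}\cdot S\cup S\cdot S^{(k)}$ (sets of products), i.e. $S^{(m)}$ consists of the words $X_1X_2\cdots X_{m-1}s_m$ with $X_i\in\{L_{s_i},R_{s_i}\}$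 and $s_1,\dots,s_m\in S$. Swapping words. $x\in S^{(m)}$ is left swapping if $x=L_{x_m}R_{x_{m-1}}L_{x_{m-2}}\cdots x_1$ (the operators alternate between $L$ and $R$, the outermost being $L$) for some $x_1,\dots,x_m\in S$; it is right swapping if $x=R_{x_m}L_{x_{m-1}}R_{x_{m-2}}\cdots x_1$ (alternating, the outermost being $R$). A single letter is both left and right swapping. In both cases $x_1$ is the inner letter of $x$, and $x_2,\dots,x_m$ are the outer letters of $x$. Equivalence. For $x,y\in\pm S^\infty$ with $l(x)=l(y)=m\ge1$, write $x\sim y$ ($x$ and $y$ are equivalent) if $x-y\in\mathcal{L}_{m-1}(S)$. Formal equivalence (for descendingly flexible $\mathcal{A}$). Elementary equivalences are defined inductively: for words $a,b,c$ of length $\ge1$, $(ab)c\sim-(cb)a$ and $a(bc)\sim-c(ba)$ are elementary; if $u\sim v$ is elementary and $z\in S^\infty$, then $uz\sim vz$ and $zu\sim zv$ are elementary. Two signed words are formally equivalent if they are connected by a chain of elementary equivalences. Swappability (for descendingly flexible $\mathcal{A}$). Two letters (occurrences) $s,t$ of a word $x$ are swappable if $x$ is formally equivalent to some (signed) word of the form $\dots R_sL_t\dots$ or of the form $\dots L_sR_t\dots$, i.e. one containing a subword $R_sL_t(v)=(tv)s$ or $L_sR_t(v)=s(vt)$ for some nonempty word $v$; here the occurrences of letters are tracked through the elementary equivalences. This relation is symmetric and transitive, and the classes of pairwise swappable letters of a word are the maximal sets of its letters in which any two distinct letters are swappable (a letter swappable with no other letter forms a class by itself). *)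

theory Defs
  imports Complex_Main "HOL-Library.Multiset" "HOL-Library.Disjoint_Sets"
begin

section \<open>Bracketed words\<close>

text \<open>
  Words are bracketed expressions. The word \<open>e\<close> of length \<open>0\<close> is not represented here; it enters
  only through the span of the words of length at most \<open>k\<close> (see \<open>word_span\<close> below).
\<close>

datatype 'l bword = Letter 'l | Prod "'l bword" "'l bword" (infixl "\<cdot>" 70)

fun letters :: "'l bword \<Rightarrow> 'l list" where
  "letters (Letter a) = [a]"
| "letters (u \<cdot> v) = letters u @ letters v"

definition len :: "'l bword \<Rightarrow> nat" where
  "len u = length (letters u)"

text \<open>
  Occurrences of letters: \<open>occ w\<close> has the shape of \<open>w\<close>, its letters being the positions
  \<open>0, \<dots>, len w - 1\<close> from left to right. A \<open>nat bword\<close> over these positions describes a word built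
  from the occurrences of letters of \<open>w\<close>; the letters themselves are recovered by
  \<open>map_bword (\<lambda>i. letters w ! i)\<close>.
\<close>

fun occ_from :: "nat \<Rightarrow> 'l bword \<Rightarrow> nat bword" where
  "occ_from k (Letter a) = Letter k"
| "occ_from k (u \<cdot> v) = occ_from k u \<cdot> occ_from (k + len u) v"

abbreviation occ :: "'l bword \<Rightarrow> nat bword" where
  "occ \<equiv> occ_from 0"

fun spow :: "'l set \<Rightarrow> nat \<Rightarrow> 'l bword set" where
  "spow S 0 = {}"
| "spow S (Suc 0) = Letter ` S"
| "spow S (Suc (Suc k)) =
     {u \<cdot> Letter s | u s. u \<in> spow S (Suc k) \<and> s \<in> S} \<union>
     {Letter s \<cdot> u | u s. u \<in> spow S (Suc k) \<and> s \<in> S}"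

fun left_swapping :: "'l bword \<Rightarrow> bool" and right_swapping :: "'l bword \<Rightarrow> bool" where
  "left_swapping (Letter a) = True"
| "left_swapping (u \<cdot> v) = ((\<exists>a. u = Letter a) \<and> right_swapping v)"
| "right_swapping (Letter a) = True"
| "right_swapping (u \<cdot> v) = ((\<exists>a. v = Letter a) \<and> left_swapping u)"

text \<open>
  Inner and outer letters depend on whether a word is read as left or as right swapping: a word
  \<open>ab\<close> of length 2 is both, with inner letter \<open>b\<close> in the first and \<open>a\<close> in the second reading. The
  functions with suffix L (R) are meant for left (right) swapping words.
\<close>

fun innerL :: "'l bword \<Rightarrow> 'l" and innerR :: "'l bword \<Rightarrow> 'l" where
  "innerL (Letter a) = a"
| "innerL (u \<cdot> v) = innerR v"
| "innerR (Letter a) = a"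
| "innerR (u \<cdot> v) = innerL u"

fun outerL :: "'l bword \<Rightarrow> 'l set" and outerR :: "'l bword \<Rightarrow> 'l set" where
  "outerL (Letter a) = {}"
| "outerL (u \<cdot> v) = set (letters u) \<union> outerR v"
| "outerR (Letter a) = {}"
| "outerR (u \<cdot> v) = set (letters v) \<union> outerL u"


section \<open>Signed words, formal equivalence and swappability\<close>

datatype 'l sword = Pos "'l bword" | Neg "'l bword"

fun unsigned :: "'l sword \<Rightarrow> 'l bword" where
  "unsigned (Pos u) = u"
| "unsigned (Neg u) = u"

fun smul_right :: "'l sword \<Rightarrow> 'l bword \<Rightarrow> 'l sword" where
  "smul_right (Pos u) z = Pos (u \<cdot> z)"
| "smul_right (Neg u) z = Neg (u \<cdot> z)"

fun smul_left :: "'l bword \<Rightarrow> 'l sword \<Rightarrow> 'l sword" where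
  "smul_left z (Pos u) = Pos (z \<cdot> u)"
| "smul_left z (Neg u) = Neg (z \<cdot> u)"

inductive elementary :: "'l sword \<Rightarrow> 'l sword \<Rightarrow> bool" where
  elem_left: "elementary (Pos ((a \<cdot> b) \<cdot> c)) (Neg ((c \<cdot> b) \<cdot> a))"
| elem_right: "elementary (Pos (a \<cdot> (b \<cdot> c))) (Neg (c \<cdot> (b \<cdot> a)))"
| elem_mul_right: "elementary u v \<Longrightarrow> elementary (smul_right u z) (smul_right v z)"
| elem_mul_left: "elementary u v \<Longrightarrow> elementary (smul_left z u) (smul_left z v)"

abbreviation formally_equivalent :: "'l sword \<Rightarrow> 'l sword \<Rightarrow> bool" where
  "formally_equivalent \<equiv> equivclp elementary"

fun subwords :: "'l bword \<Rightarrow> 'l bword set" where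
  "subwords (Letter a) = {Letter a}"
| "subwords (u \<cdot> v) = insert (u \<cdot> v) (subwords u \<union> subwords v)"

text \<open>
  Swappability is a notion for occurrences. The following definitions are meant for words whose
  letters are pairwise distinct labels, so that an occurrence is tracked by its label.
\<close>

definition swappable :: "'l bword \<Rightarrow> 'l \<Rightarrow> 'l \<Rightarrow> bool" where
  "swappable w s t \<longleftrightarrow>
     (\<exists>w'. formally_equivalent (Pos w) w' \<and>
        (\<exists>v. (Letter t \<cdot> v) \<cdot> Letter s \<in> subwords (unsigned w') \<or>
             Letter s \<cdot> (v \<cdot> Letter t) \<in> subwords (unsigned w')))"

definition swap_classes :: "'l bword \<Rightarrow> 'l set set" where
  "swap_classes w =
     {C. C \<subseteq> set (letters w) \<and> pairwise (swappable w) C \<and>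
         (\<forall>D. C \<subseteq> D \<and> D \<subseteq> set (letters w) \<and> pairwise (swappable w) D \<longrightarrow> D = C)}"


section \<open>Words of the form (xy)z and z'(y'x')\<close>

text \<open>\<open>FormL x y z\<close> stands for \<open>(xy)z\<close> and \<open>FormR z y x\<close> for \<open>z(yx)\<close>.\<close>

datatype 'l form =
  FormL (fx: "'l bword") (fy: "'l bword") (fz: "'l bword")
| FormR (fz: "'l bword") (fy: "'l bword") (fx: "'l bword")

fun form_word :: "'l form \<Rightarrow> 'l bword" where
  "form_word (FormL x y z) = (x \<cdot> y) \<cdot> z"
| "form_word (FormR z y x) = z \<cdot> (y \<cdot> x)"

fun swapping_form :: "'l form \<Rightarrow> bool" where
  "swapping_form (FormL x y z) = (left_swapping x \<and> right_swapping y \<and> right_swapping z)"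
| "swapping_form (FormR z y x) = (left_swapping z \<and> left_swapping y \<and> right_swapping x)"

datatype length_case = Case_EOO | Case_OEE | Case_O11 | Case_OO | Case_OE

fun length_condition :: "length_case \<Rightarrow> nat \<Rightarrow> nat \<Rightarrow> nat \<Rightarrow> bool" where
  "length_condition Case_EOO lx ly lz = (even lx \<and> odd ly \<and> odd lz)"
| "length_condition Case_OEE lx ly lz = (odd lx \<and> even ly \<and> even lz)"
| "length_condition Case_O11 lx ly lz = (odd lx \<and> ly = 1 \<and> lz = 1)"
| "length_condition Case_OO lx ly lz = (lx = 1 \<and> even ly \<and> odd lz)"
| "length_condition Case_OE lx ly lz = (odd lx \<and> odd ly \<and> ly \<ge> 3 \<and> lz = 1)"

text \<open>
  The factors \<open>u\<close>, \<open>v\<close> used in the cases OO and OE. In case OO the word is \<open>uv\<close> itself; in case OE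
  the word \<open>(xy)z\<close> is replaced by \<open>uv = (zy)x\<close>, and \<open>z'(y'x')\<close> by \<open>v'u' = x'(y'z')\<close>. (The values
  in the other cases are irrelevant.)
\<close>

fun factor_u :: "length_case \<Rightarrow> 'l form \<Rightarrow> 'l bword" where
  "factor_u Case_OE (FormL x y z) = z \<cdot> y"
| "factor_u Case_OE (FormR z y x) = y \<cdot> z"
| "factor_u _ (FormL x y z) = x \<cdot> y"
| "factor_u _ (FormR z y x) = z"

fun factor_v :: "length_case \<Rightarrow> 'l form \<Rightarrow> 'l bword" where
  "factor_v Case_OE (FormL x y z) = x"
| "factor_v Case_OE (FormR z y x) = x"
| "factor_v _ (FormL x y z) = z"
| "factor_v _ (FormR z y x) = y \<cdot> x"

fun letter_types :: "length_case \<Rightarrow> 'l form \<Rightarrow> 'l set set" where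
  "letter_types Case_OEE (FormL x y z) =
     {insert (innerL x) (outerR y), insert (innerR y) (outerR z), insert (innerR z) (outerL x)}"
| "letter_types Case_OEE (FormR z y x) =
     {insert (innerR x) (outerL y), insert (innerL y) (outerL z), insert (innerL z) (outerR x)}"
| "letter_types Case_OO f = (let u = factor_u Case_OO f; v = factor_v Case_OO f in
     {insert (innerR v) (outerL u), insert (innerL u) (outerR v)})"
| "letter_types Case_OE (FormL x y z) =
     (let u = factor_u Case_OE (FormL x y z); v = factor_v Case_OE (FormL x y z) in
     {insert (innerL v) (outerL u), insert (innerL u) (outerL v)})"
| "letter_types Case_OE (FormR z y x) =
     (let u = factor_u Case_OE (FormR z y x); v = factor_v Case_OE (FormR z y x) in
     {insert (innerR v) (outerR u), insert (innerR u) (outerR v)})"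
| "letter_types _ (FormL x y z) = \<comment> \<open>Case_EOO and Case_O11\<close>
     {insert (innerL x) (outerR z), insert (innerR y) (outerL x), insert (innerR z) (outerR y)}"
| "letter_types _ (FormR z y x) =
     {insert (innerR x) (outerL z), insert (innerL y) (outerR x), insert (innerL z) (outerL y)}"


section \<open>Algebras\<close>

locale nonassoc_algebra = vector_space scale
  for scale :: "'f::field \<Rightarrow> 'a::ab_group_add \<Rightarrow> 'a" +
  fixes mul :: "'a \<Rightarrow> 'a \<Rightarrow> 'a"
  assumes linear_mul_left: "Vector_Spaces.linear scale scale (\<lambda>x. mul x b)"
    and linear_mul_right: "Vector_Spaces.linear scale scale (\<lambda>x. mul a x)"
begin

text \<open>The set of unities: \<open>{e}\<close> if the algebra is unital, and empty otherwise.\<close>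

definition unities :: "'a set" where
  "unities = {e. \<forall>x. mul e x = x \<and> mul x e = x}"

definition L1_span :: "'a \<Rightarrow> 'a \<Rightarrow> 'a set" where
  "L1_span a b = span ({a, b, mul a a, mul a b, mul b a} \<union> unities)"

definition L2_span :: "'a \<Rightarrow> 'a \<Rightarrow> 'a \<Rightarrow> 'a set" where
  "L2_span a b c =
     span ({a, b, c, mul a b, mul b a, mul c b, mul b c, mul a c, mul c a} \<union> unities)"

definition descendingly_flexible :: bool where
  "descendingly_flexible \<longleftrightarrow>
     (\<forall>a b. mul (mul a b) a \<in> L1_span a b \<and> mul a (mul b a) \<in> L1_span a b) \<and>
     (\<forall>a b c. mul (mul a b) c + mul (mul c b) a \<in> L2_span a b c) \<and>
     (\<forall>a b c. mul a (mul b c) + mul c (mul b a) \<in> L2_span a b c)"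

primrec val :: "'a bword \<Rightarrow> 'a" where
  "val (Letter a) = a"
| "val (u \<cdot> v) = mul (val u) (val v)"

fun sval :: "'a sword \<Rightarrow> 'a" where
  "sval (Pos u) = val u"
| "sval (Neg u) = - val u"

definition word_span :: "'a set \<Rightarrow> nat \<Rightarrow> 'a set" where
  "word_span S k = span (val ` {u. set (letters u) \<subseteq> S \<and> len u \<le> k} \<union> unities)"

definition equivalent :: "'a set \<Rightarrow> 'a sword \<Rightarrow> 'a sword \<Rightarrow> bool" where
  "equivalent S x y \<longleftrightarrow>
     set (letters (unsigned x)) \<subseteq> S \<and> set (letters (unsigned y)) \<subseteq> S \<and>
     len (unsigned x) = len (unsigned y) \<and>
     sval x - sval y \<in> word_span S (len (unsigned x) - 1)"

text \<open>
  \<open>represents S w f\<close>: here \<open>f\<close> is a form over the occurrences of letters of \<open>w\<close>. It uses every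
  occurrence exactly once, that is, its word is obtained from \<open>w\<close> by a permutation of letters; the
  permutation preserves the classes of swappable letters; and with the letters of \<open>w\<close> put in, the
  word is equivalent to \<open>w\<close> up to sign.
\<close>

definition represents :: "'a set \<Rightarrow> 'a bword \<Rightarrow> nat form \<Rightarrow> bool" where
  "represents S w f \<longleftrightarrow>
     swapping_form f \<and>
     mset (letters (form_word f)) = mset (letters (occ w)) \<and>
     swap_classes (form_word f) = swap_classes (occ w) \<and>
     (let p = map_bword (\<lambda>i. letters w ! i) (form_word f)
      in equivalent S (Pos w) (Pos p) \<or> equivalent S (Pos w) (Neg p))"

text \<open>
  Besides the parities, the cases Case_OO and Case_OE contain the stated properties of \<open>u\<close> and \<open>v\<close>. In case
  Case_OE, \<open>w \<sim> \<plusminus>(xy)z \<sim> \<minusplus>(zy)x\<close> (and its mirror image) is expressed by \<open>represents\<close> together with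
  \<open>(xy)z \<sim> -(zy)x\<close>.
\<close>

fun case_properties :: "'a set \<Rightarrow> 'a bword \<Rightarrow> length_case \<Rightarrow> nat form \<Rightarrow> bool" where
  "case_properties S w Case_OO f =
     (let u = factor_u Case_OO f; v = factor_v Case_OO f in
       form_word f = u \<cdot> v \<and>
       left_swapping u \<and> odd (len u) \<and> right_swapping v \<and> odd (len v) \<and> (len u > 1 \<or> len v > 1))"
| "case_properties S w Case_OE (FormL x y z) =
     (let f = FormL x y z; u = factor_u Case_OE f; v = factor_v Case_OE f; \<phi> = map_bword (\<lambda>i. letters w ! i) in
       left_swapping u \<and> even (len u) \<and> len u \<ge> 4 \<and> left_swapping v \<and> odd (len v) \<and>
       equivalent S (Pos (\<phi> (form_word f))) (Neg (\<phi> (u \<cdot> v))))"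
| "case_properties S w Case_OE (FormR z y x) =
     (let f = FormR z y x; u = factor_u Case_OE f; v = factor_v Case_OE f; \<phi> = map_bword (\<lambda>i. letters w ! i) in
       right_swapping u \<and> even (len u) \<and> len u \<ge> 4 \<and> right_swapping v \<and> odd (len v) \<and>
       equivalent S (Pos (\<phi> (form_word f))) (Neg (\<phi> (v \<cdot> u))))"
| "case_properties S w _ f = True"

definition in_case :: "'a set \<Rightarrow> 'a bword \<Rightarrow> length_case \<Rightarrow> nat form \<Rightarrow> bool" where
  "in_case S w K f \<longleftrightarrow>
     length_condition K (len (fx f)) (len (fy f)) (len (fz f)) \<and> case_properties S w K f"

end

locale descendingly_flexible_algebra = nonassoc_algebra +
  assumes descendingly_flexible: descendingly_flexible

end

theory Submission
  imports Defs "HOL-Combinatorics.Transposition"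
begin

text \<open>
  Every word of the shape \<open>(xy)z\<close> or \<open>z'(y'x')\<close> with swapping factors keeps this shape under
  multiplication by a letter \<open>s\<close>: up to sign, \<open>s((xy)z)\<close> becomes \<open>x((sy)z)\<close>, and \<open>((xy)z)s\<close> becomes
  \<open>(sz)(xy)\<close>. This exchanges the length patterns EOO and OEE, and takes OO to O11 or OE and back. The
  only products outside the five cases, \<open>(sz)(xy)\<close> from O11 or OE, are brought to EOO by shifting
  the letters of \<open>y\<close>, two at a time, to \<open>sz\<close>.

  Exchanging two swappable letters fixes the formal equivalence class up to sign, hence
  swappability is transitive on words with distinct letters. For the letter types it therefore
  suffices to exhibit one swappable pair connecting each inner letter to the corresponding outer
  letters.
\<close>

section \<open>Formal equivalence of unsigned words\<close>

lemma len_simps [simp]: "len (Letter a) = 1" "len (u \<cdot> v) = len u + len v"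
  by (simp_all add: len_def)

lemma len_pos [simp]: "0 < len u"
  by (induction u) auto

lemma len_ge_1 [simp]: "Suc 0 \<le> len u"
  using len_pos[of u] by linarith

lemma len_1_iff: "len u = Suc 0 \<longleftrightarrow> (\<exists>a. u = Letter a)"
proof (cases u)
  case (Prod v w)
  then show ?thesis using len_pos[of v] len_pos[of w] by (simp del: len_pos)
qed simp

text \<open>
  An elementary equivalence always goes from a positive to a negative word, and its unsigned
  reversal is elementary too. So the signs play no role for which words can be reached.
\<close>

definition weq :: "'l bword \<Rightarrow> 'l bword \<Rightarrow> bool" (infix "\<approx>" 50) where
  "weq = equivclp (\<lambda>u v. elementary (Pos u) (Neg v))"

text \<open>Both base rules exchange the outer factors \<open>a\<close> and \<open>c\<close>, so
  each is its own inverse up to signs, and the congruence rules leave the signs alone.\<close>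

lemma elementaryD:
  "elementary x y \<Longrightarrow> x = Pos (unsigned x) \<and> y = Neg (unsigned y) \<and>
     elementary (Pos (unsigned y)) (Neg (unsigned x))"
proof (induction rule: elementary.induct)
  case (elem_mul_right x y z)
  then obtain u v where "x = Pos u" "y = Neg v" "elementary (Pos v) (Neg u)" by metis
  then show ?case using elementary.elem_mul_right[of "Pos v" "Neg u" z] by simp
next
  case (elem_mul_left x y z)
  then obtain u v where "x = Pos u" "y = Neg v" "elementary (Pos v) (Neg u)" by metis
  then show ?case using elementary.elem_mul_left[of "Pos v" "Neg u" z] by simp
qed (simp_all add: elem_left elem_right)

lemma elementary_sym: "elementary (Pos u) (Neg v) \<Longrightarrow> elementary (Pos v) (Neg u)"
  by (drule elementaryD) simp

text \<open>Unsigned elementary steps are reversible, so the backward steps of a chain can be read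
  as forward ones and a single induction step remains.\<close>

lemma weq_induct [consumes 1, case_names refl step]:
  assumes "u \<approx> v" and "P u"
    and "\<And>v v'. u \<approx> v \<Longrightarrow> elementary (Pos v) (Neg v') \<Longrightarrow> P v \<Longrightarrow> P v'"
  shows "P v"
  using assms(1) unfolding weq_def
proof (induction rule: equivclp_induct)
  case base
  show ?case by (rule assms(2))
next
  case (step y z)
  then show ?case using assms(3)[of y z] elementary_sym[of z y] by (auto simp: weq_def)
qed

lemma weq_refl [simp, intro]: "u \<approx> u"
  by (simp add: weq_def)

lemma weq_sym: "u \<approx> v \<Longrightarrow> v \<approx> u"
  unfolding weq_def by (rule equivclp_sym)

lemma weq_trans [trans]: "u \<approx> v \<Longrightarrow> v \<approx> w \<Longrightarrow> u \<approx> w"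
  unfolding weq_def by (rule equivclp_trans)

lemma weq_step: "elementary (Pos u) (Neg v) \<Longrightarrow> u \<approx> v"
  unfolding weq_def by (rule r_into_equivclp)

lemma weq_swapL: "(a \<cdot> b) \<cdot> c \<approx> (c \<cdot> b) \<cdot> a"
  by (rule weq_step) (rule elem_left)

lemma weq_swapR: "a \<cdot> (b \<cdot> c) \<approx> c \<cdot> (b \<cdot> a)"
  by (rule weq_step) (rule elem_right)

lemma weq_mul_right: "u \<approx> v \<Longrightarrow> u \<cdot> z \<approx> v \<cdot> z"
proof (induction rule: weq_induct)
  case (step v v')
  then show ?case using elem_mul_right[of "Pos v" "Neg v'" z] by (auto intro: weq_trans weq_step)
qed simp

lemma weq_mul_left: "u \<approx> v \<Longrightarrow> z \<cdot> u \<approx> z \<cdot> v"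
proof (induction rule: weq_induct)
  case (step v v')
  then show ?case using elem_mul_left[of "Pos v" "Neg v'" z] by (auto intro: weq_trans weq_step)
qed simp

lemma weq_cong: "u \<approx> u' \<Longrightarrow> v \<approx> v' \<Longrightarrow> u \<cdot> v \<approx> u' \<cdot> v'"
  by (rule weq_trans[OF weq_mul_right weq_mul_left])

lemma unsigned_smul [simp]:
  "unsigned (smul_right x z) = unsigned x \<cdot> z" "unsigned (smul_left z x) = z \<cdot> unsigned x"
  by (cases x; simp)+

text \<open>The last two premises do not fix on which side the image of \<open>z\<close> appears.
  This covers homomorphisms such as renaming of letters as well as the antiautomorphism
  \<open>mirror\<close>.\<close>

lemma weq_transfer:
  assumes "u \<approx> v"
    and "\<And>a b c. f ((a \<cdot> b) \<cdot> c) \<approx> f ((c \<cdot> b) \<cdot> a)"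
    and "\<And>a b c. f (a \<cdot> (b \<cdot> c)) \<approx> f (c \<cdot> (b \<cdot> a))"
    and "\<And>u v z. f u \<approx> f v \<Longrightarrow> f (u \<cdot> z) \<approx> f (v \<cdot> z)"
    and "\<And>u v z. f u \<approx> f v \<Longrightarrow> f (z \<cdot> u) \<approx> f (z \<cdot> v)"
  shows "f u \<approx> f v"
  using assms(1)
proof (induction rule: weq_induct)
  case (step v v')
  have "f (unsigned x) \<approx> f (unsigned y)" if "elementary x y" for x y
    using that
    by (induction rule: elementary.induct) (simp_all add: assms(2-5))
  from this[OF step(2)] step(3) show ?case by (auto intro: weq_trans)
qed simp

lemma weq_map: "u \<approx> v \<Longrightarrow> map_bword g u \<approx> map_bword g v"
  by (erule weq_transfer) (auto intro: weq_swapL weq_swapR weq_cong)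

lemma letters_map: "letters (map_bword g u) = map g (letters u)"
  by (induction u) auto

lemma len_map [simp]: "len (map_bword g u) = len u"
  by (simp add: len_def letters_map)

section \<open>Invariants of formal equivalence and comparison with signed words\<close>

lemma elementary_mset:
  "elementary x y \<Longrightarrow> mset (letters (unsigned x)) = mset (letters (unsigned y))"
  by (induction rule: elementary.induct) auto

lemma weq_mset: "u \<approx> v \<Longrightarrow> mset (letters u) = mset (letters v)"
  by (induction rule: weq_induct) (auto dest: elementary_mset)

lemma weq_set: "u \<approx> v \<Longrightarrow> set (letters u) = set (letters v)"
  by (metis weq_mset mset_eq_setD)

lemma weq_len: "u \<approx> v \<Longrightarrow> len u = len v"
  by (metis weq_mset mset_eq_length len_def)

lemma weq_distinct: "u \<approx> v \<Longrightarrow> distinct (letters u) \<longleftrightarrow> distinct (letters v)"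
  by (metis weq_mset mset_eq_imp_distinct_iff)

lemma formally_equivalent_imp_weq:
  "formally_equivalent x y \<Longrightarrow> unsigned x \<approx> unsigned y"
proof (induction rule: equivclp_induct)
  case (step y z)
  have "unsigned y \<approx> unsigned z"
  proof (rule disjE[OF step(2)])
    assume "elementary y z"
    then show ?thesis using elementaryD[of y z] by (metis weq_step)
  next
    assume "elementary z y"
    then show ?thesis using elementaryD[of z y] by (metis weq_step weq_sym)
  qed
  with step(3) show ?case by (rule weq_trans)
qed simp

text \<open>The sign of \<open>y\<close> is the parity of the number of steps, which is left
  implicit.\<close>

lemma weq_imp_formally_equivalent:
  "u \<approx> v \<Longrightarrow> \<exists>y. formally_equivalent (Pos u) y \<and> unsigned y = v"
proof (induction rule: weq_induct)
  case refl
  show ?case by (rule exI[of _ "Pos u"]) simp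
next
  case (step v v')
  then obtain y where y: "formally_equivalent (Pos u) y" "unsigned y = v" by blast
  have "elementary (Pos v') (Neg v)"
    using step(2) by (rule elementary_sym)
  show ?case
  proof (cases y)
    case (Pos _)
    then have "formally_equivalent y (Neg v')" using step(2) y(2) by (auto intro: r_into_equivclp)
    then show ?thesis using equivclp_trans[OF y(1)] by (metis unsigned.simps(2))
  next
    case (Neg _)
    \<comment> \<open>No elementary equivalence starts from a negative word, so the chain is
      continued by the reversed step, read backwards.\<close>
    then have "formally_equivalent y (Pos v')"
      using \<open>elementary (Pos v') (Neg v)\<close> y(2) by (auto intro: converse_r_into_equivclp)
    then show ?thesis using equivclp_trans[OF y(1)] by (metis unsigned.simps(1))
  qed
qed


section \<open>Swappability is an equivalence relation\<close>

text \<open>The reflexive closure allows classes to be written as \<open>{t. linked w s t}\<close>,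
  in agreement with \<open>swap_classes\<close>, which only compares distinct letters.\<close>

definition linked :: "'l bword \<Rightarrow> 'l \<Rightarrow> 'l \<Rightarrow> bool" where
  "linked w s t \<longleftrightarrow> s = t \<or> swappable w s t"

lemma swappable_iff:
  "swappable w s t \<longleftrightarrow>
     (\<exists>w' v. w \<approx> w' \<and> ((Letter t \<cdot> v) \<cdot> Letter s \<in> subwords w' \<or>
                          Letter s \<cdot> (v \<cdot> Letter t) \<in> subwords w'))"
proof -
  have "(\<exists>w'. formally_equivalent (Pos w) w' \<and> P (unsigned w')) \<longleftrightarrow> (\<exists>w'. w \<approx> w' \<and> P w')" for P
    using formally_equivalent_imp_weq[of "Pos w"] weq_imp_formally_equivalent[of w] by fastforce
  from this[of "\<lambda>w'. \<exists>v. (Letter t \<cdot> v) \<cdot> Letter s \<in> subwords w' \<or>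
                        Letter s \<cdot> (v \<cdot> Letter t) \<in> subwords w'"]
  show ?thesis unfolding swappable_def by (simp only: ex_simps)
qed

lemma subwords_refl [simp]: "u \<in> subwords u"
  by (cases u) auto

lemma swappable_weq: "u \<approx> v \<Longrightarrow> swappable u s t \<longleftrightarrow> swappable v s t"
proof -
  assume "u \<approx> v"
  then have *: "u \<approx> w \<longleftrightarrow> v \<approx> w" for w 
    using weq_trans[of u v w] weq_trans[of v u w] weq_sym[of u v] by blast
  show ?thesis unfolding swappable_iff * by (rule refl)
qed

lemma linked_weq: "u \<approx> v \<Longrightarrow> linked u s t \<longleftrightarrow> linked v s t"
  by (simp add: linked_def swappable_weq)

lemma swap_classes_weq: "u \<approx> v \<Longrightarrow> swap_classes u = swap_classes v"
proof -
  assume "u \<approx> v"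
  then have "set (letters u) = set (letters v)" "swappable u = swappable v"
    by (simp_all add: weq_set swappable_weq fun_eq_iff)
  then show ?thesis by (simp add: swap_classes_def)
qed

lemma swappable_mul: "swappable u s t \<Longrightarrow> swappable (u \<cdot> v) s t \<and> swappable (v \<cdot> u) s t"
proof -
  assume "swappable u s t"
  then obtain w' r where w': "u \<approx> w'"
    "(Letter t \<cdot> r) \<cdot> Letter s \<in> subwords w' \<or> Letter s \<cdot> (r \<cdot> Letter t) \<in> subwords w'"
    unfolding swappable_iff by blast
  show ?thesis
  proof
    show "swappable (u \<cdot> v) s t"
      unfolding swappable_iff using w'(2) weq_mul_right[OF w'(1), of v]
      by (intro exI[of _ "w' \<cdot> v"] exI[of _ r]) auto
    show "swappable (v \<cdot> u) s t"
      unfolding swappable_iff using w'(2) weq_mul_left[OF w'(1), of v]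
      by (intro exI[of _ "v \<cdot> w'"] exI[of _ r]) auto
  qed
qed

lemma linked_mulI1: "linked u s t \<Longrightarrow> linked (u \<cdot> v) s t"
  and linked_mulI2: "linked v s t \<Longrightarrow> linked (u \<cdot> v) s t"
  by (auto simp: linked_def swappable_mul)

lemma subwords_replace:
  assumes "p \<in> subwords w" "p \<approx> q"
  shows "\<exists>w'. w \<approx> w' \<and> q \<in> subwords w'"
  using assms(1)
proof (induction w)
  case (Letter a)
  then show ?case using assms(2) subwords_refl by force
next
  case (Prod u v)
  then consider "p = u \<cdot> v" | "p \<in> subwords u" | "p \<in> subwords v" by auto
  then show ?case
  proof cases
    case 1
    then show ?thesis using assms(2) subwords_refl by blast
  next
    case 2
    then obtain u' where "u \<approx> u'" "q \<in> subwords u'" using Prod by blast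
    then show ?thesis by (intro exI[of _ "u' \<cdot> v"]) (simp add: weq_mul_right)
  next
    case 3
    then obtain v' where "v \<approx> v'" "q \<in> subwords v'" using Prod by blast
    then show ?thesis by (intro exI[of _ "u \<cdot> v'"]) (simp add: weq_mul_left)
  qed
qed

text \<open>One elementary equivalence, applied to the subword witnessing swappability, interchanges
  its two end letters.\<close>

lemma swappable_sym:
  assumes "swappable w s t"
  shows "swappable w t s"
proof -
  obtain w' v where w': "w \<approx> w'"
    "(Letter t \<cdot> v) \<cdot> Letter s \<in> subwords w' \<or> Letter s \<cdot> (v \<cdot> Letter t) \<in> subwords w'"
    using assms unfolding swappable_iff by blast
  then obtain w'' where w'': "w' \<approx> w''"
    "(Letter s \<cdot> v) \<cdot> Letter t \<in> subwords w'' \<or> Letter t \<cdot> (v \<cdot> Letter s) \<in> subwords w''"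
    using subwords_replace[OF _ weq_swapL, of "Letter t" v "Letter s" w']
      subwords_replace[OF _ weq_swapR, of "Letter s" v "Letter t" w'] by blast
  then show ?thesis
    unfolding swappable_iff using weq_trans[OF w'(1) w''(1)] by blast
qed

lemma linked_sym: "linked w s t \<Longrightarrow> linked w t s"
  by (auto simp: linked_def intro: swappable_sym)

lemma subwords_letters: "p \<in> subwords w \<Longrightarrow> set (letters p) \<subseteq> set (letters w)"
  by (induction w) auto

lemma subwords_distinct: "p \<in> subwords w \<Longrightarrow> distinct (letters w) \<Longrightarrow> distinct (letters p)"
  by (induction w) auto

lemma subwords_map: "p \<in> subwords w \<Longrightarrow> map_bword g p \<in> subwords (map_bword g w)"
  by (induction w) auto

lemma map_bword_idI: "(\<And>a. a \<in> set (letters u) \<Longrightarrow> g a = a) \<Longrightarrow> map_bword g u = u"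
  by (induction u) auto

lemma swappable_letters: "swappable w s t \<Longrightarrow> s \<in> set (letters w) \<and> t \<in> set (letters w)"
  unfolding swappable_iff
  by (auto dest!: subwords_letters dest: weq_set)

text \<open>Since the letters of \<open>w\<close> are distinct, those of \<open>p\<close> occur
  nowhere else in \<open>w\<close>. A renaming that moves only letters of \<open>p\<close> therefore
  changes \<open>w\<close> just at this subword.\<close>

lemma weq_map_subword:
  assumes "p \<in> subwords w" "distinct (letters w)" "p \<approx> map_bword g p"
    and "\<And>a. a \<notin> set (letters p) \<Longrightarrow> g a = a"
  shows "w \<approx> map_bword g w"
  using assms(1,2)
proof (induction w)
  case (Letter a)
  then show ?case using assms(3) by auto
next
  case (Prod u v)
  then consider "p = u \<cdot> v" | "p \<in> subwords u" | "p \<in> subwords v" by auto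
  then show ?case
  proof cases
    case 1
    then show ?thesis using assms(3) by simp
  next
    case 2
    then have "map_bword g v = v"
      using Prod.prems(2) subwords_letters[of p u] by (intro map_bword_idI assms(4)) auto
    then show ?thesis using Prod 2 by (simp add: weq_mul_right)
  next
    case 3
    then have "map_bword g u = u"
      using Prod.prems(2) subwords_letters[of p v] by (intro map_bword_idI assms(4)) auto
    then show ?thesis using Prod 3 by (simp add: weq_mul_left)
  qed
qed

text \<open>On the witnessing subword the elementary equivalence that swaps the ends is exactly the
  renaming by the transposition of \<open>s\<close> and \<open>t\<close>.\<close>

lemma swappable_transpose:
  assumes "distinct (letters w)" "swappable w s t"
  shows "w \<approx> map_bword (transpose s t) w"
proof -
  let ?g = "transpose s t"
  obtain w' v where w': "w \<approx> w'"
    and sub: "(Letter t \<cdot> v) \<cdot> Letter s \<in> subwords w' \<or> Letter s \<cdot> (v \<cdot> Letter t) \<in> subwords w'"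
    using assms(2) unfolding swappable_iff by blast
  have dist: "distinct (letters w')" using weq_distinct[OF w'] assms(1) by simp
  have fixv: "map_bword ?g v = v" if "s \<notin> set (letters v)" "t \<notin> set (letters v)"
    using that by (intro map_bword_idI) (auto simp: transpose_def)
  from sub have "w' \<approx> map_bword ?g w'"
  proof
    assume p: "(Letter t \<cdot> v) \<cdot> Letter s \<in> subwords w'"
    show ?thesis
    proof (rule weq_map_subword[OF p dist])
      have "map_bword ?g v = v" using subwords_distinct[OF p dist] by (intro fixv) auto
      then show "(Letter t \<cdot> v) \<cdot> Letter s \<approx> map_bword ?g ((Letter t \<cdot> v) \<cdot> Letter s)"
        by (simp add: weq_swapL)
    qed (auto simp: transpose_def)
  next
    assume p: "Letter s \<cdot> (v \<cdot> Letter t) \<in> subwords w'"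
    show ?thesis
    proof (rule weq_map_subword[OF p dist])
      have "map_bword ?g v = v" using subwords_distinct[OF p dist] by (intro fixv) auto
      then show "Letter s \<cdot> (v \<cdot> Letter t) \<approx> map_bword ?g (Letter s \<cdot> (v \<cdot> Letter t))"
        by (simp add: weq_swapR)
    qed (auto simp: transpose_def)
  qed
  then have "w \<approx> map_bword ?g w'" by (rule weq_trans[OF w'])
  \<comment> \<open>Applying the renaming to the whole chain from \<open>w\<close> to
    \<open>w'\<close> leads back from the renamed \<open>w'\<close> to the renamed
    \<open>w\<close>.\<close>
  then show ?thesis by (rule weq_trans[OF _ weq_sym[OF weq_map[OF w']]])
qed

lemma swappable_map: "swappable w s t \<Longrightarrow> swappable (map_bword g w) (g s) (g t)"
proof -
  assume "swappable w s t"
  then obtain w' v where w': "w \<approx> w'"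
    "(Letter t \<cdot> v) \<cdot> Letter s \<in> subwords w' \<or> Letter s \<cdot> (v \<cdot> Letter t) \<in> subwords w'"
    unfolding swappable_iff by blast
  show ?thesis
    unfolding swappable_iff using w'(2) weq_map[OF w'(1), of g]
    by (intro exI[of _ "map_bword g w'"] exI[of _ "map_bword g v"])
      (auto dest: subwords_map[where g = g])
qed

text \<open>Conjugation: renaming by the transposition of \<open>r\<close> and \<open>s\<close>
  turns swappability of \<open>s\<close>, \<open>t\<close> into that of \<open>r\<close>,
  \<open>t\<close>, and the renamed word is equivalent to \<open>w\<close> because \<open>r\<close>,
  \<open>s\<close> are swappable.\<close>

lemma linked_trans:
  assumes "distinct (letters w)" "linked w r s" "linked w s t"
  shows "linked w r t"
proof (cases "r = s \<or> s = t \<or> r = t")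
  case False
  then have rs: "swappable w r s" and st: "swappable w s t"
    using assms by (auto simp: linked_def)
  have "transpose r s t = t" using False by (auto simp: transpose_def)
  then have "swappable (map_bword (transpose r s) w) r t"
    using swappable_map[OF st, of "transpose r s"] by simp
  then show ?thesis
    using swappable_weq[OF swappable_transpose[OF assms(1) rs]] by (simp add: linked_def)
qed (use assms in \<open>auto simp: linked_def\<close>)

lemma swap_class_of:
  assumes "distinct (letters w)" "s \<in> set (letters w)"
  shows "{t. linked w s t} \<in> swap_classes w"
proof -
  let ?C = "{t. linked w s t}"
  have "?C \<subseteq> set (letters w)"
    using assms(2) by (auto simp: linked_def dest: swappable_letters)
  moreover have "pairwise (swappable w) ?C"
    using linked_trans[OF assms(1) linked_sym] unfolding pairwise_def
    by (metis linked_def mem_Collect_eq)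
  moreover have "D = ?C" if "?C \<subseteq> D" "pairwise (swappable w) D" for D
    using that unfolding pairwise_def linked_def by blast
  ultimately show ?thesis unfolding swap_classes_def by blast
qed

lemma swap_classes_eq:
  assumes "distinct (letters w)" "C \<in> swap_classes w" "s \<in> C"
  shows "C = {t. linked w s t}"
proof -
  have C: "C \<subseteq> set (letters w)" "pairwise (swappable w) C"
    "\<And>D. C \<subseteq> D \<Longrightarrow> D \<subseteq> set (letters w) \<Longrightarrow> pairwise (swappable w) D \<Longrightarrow> D = C"
    using assms(2) unfolding swap_classes_def by blast+
  have "{t. linked w s t} \<in> swap_classes w"
    using assms(1,3) C(1) by (intro swap_class_of) auto
  moreover have "C \<subseteq> {t. linked w s t}"
    using C(2) assms(3) unfolding pairwise_def linked_def by blast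
  ultimately show ?thesis
    using C(3)[of "{t. linked w s t}"] unfolding swap_classes_def by blast
qed

text \<open>A singleton is vacuously pairwise swappable, so the empty set is never maximal.\<close>

lemma swap_classes_nonempty: "C \<in> swap_classes w \<Longrightarrow> C \<noteq> {}"
proof
  assume C: "C \<in> swap_classes w" "C = {}"
  obtain a where "a \<in> set (letters w)" using len_pos[of w] unfolding len_def by fastforce
  then show False
    using C unfolding swap_classes_def by (force dest: spec[of _ "{a}"])
qed

lemma finite_swap_classes: "finite (swap_classes w)" "C \<in> swap_classes w \<Longrightarrow> finite C"
proof -
  have "swap_classes w \<subseteq> Pow (set (letters w))" by (auto simp: swap_classes_def)
  then show "finite (swap_classes w)" "C \<in> swap_classes w \<Longrightarrow> finite C"
    by (auto intro: finite_subset)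
qed

section \<open>Sets of mutually linked letters\<close>

definition linked_set :: "'l bword \<Rightarrow> 'l set \<Rightarrow> bool" where
  "linked_set w T \<longleftrightarrow> (\<forall>s\<in>T. \<forall>t\<in>T. linked w s t)"

lemma linked_set_empty [simp]: "linked_set w {}"
  by (simp add: linked_set_def)

lemma linked_set_weq: "u \<approx> v \<Longrightarrow> linked_set u T \<longleftrightarrow> linked_set v T"
  by (simp add: linked_set_def linked_weq)

lemma linked_set_mulI1: "linked_set u T \<Longrightarrow> linked_set (u \<cdot> v) T"
  and linked_set_mulI2: "linked_set v T \<Longrightarrow> linked_set (u \<cdot> v) T"
  by (auto simp: linked_set_def intro: linked_mulI1 linked_mulI2)

text \<open>By transitivity one link to a single element suffices. The guard
  \<open>T \<noteq> {}\<close> covers words without outer letters.\<close>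

lemma linked_set_insert:
  assumes "distinct (letters w)" "linked_set w T" "T \<noteq> {} \<Longrightarrow> \<exists>t\<in>T. linked w s t"
  shows "linked_set w (insert s T)"
  unfolding linked_set_def
proof (intro ballI)
  fix a b assume ab: "a \<in> insert s T" "b \<in> insert s T"
  have s: "linked w s c" if "c \<in> insert s T" for c
  proof (cases "c = s")
    case False
    with that obtain t where "t \<in> T" "linked w s t" "linked w t c"
      using assms(2,3) unfolding linked_set_def by blast
    then show ?thesis using linked_trans[OF assms(1)] by blast
  qed (simp add: linked_def)
  show "linked w a b" by (rule linked_trans[OF assms(1) linked_sym[OF s[OF ab(1)]] s[OF ab(2)]])
qed

lemma linked_set_class:
  assumes "distinct (letters w)" "linked_set w T" "T \<noteq> {}" "T \<subseteq> set (letters w)"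
  shows "\<exists>C\<in>swap_classes w. T \<subseteq> C"
proof -
  obtain s where s: "s \<in> T" using assms(3) by blast
  then have "T \<subseteq> {t. linked w s t}" using assms(2) by (auto simp: linked_set_def)
  then show ?thesis using swap_class_of[OF assms(1)] s assms(4) by blast
qed

lemma swappable_endsL: "swappable ((Letter t \<cdot> v) \<cdot> Letter s) s t"
  and swappable_endsR: "swappable (Letter s \<cdot> (v \<cdot> Letter t)) s t"
  unfolding swappable_iff by (metis subwords_refl weq_refl)+

lemma linked_endsL: "linked ((Letter s \<cdot> v) \<cdot> Letter t) s t"
  and linked_endsR: "linked (Letter s \<cdot> (v \<cdot> Letter t)) s t"
  using swappable_endsL swappable_endsR swappable_sym by (metis linked_def)+


section \<open>Reflection\<close>

text \<open>Reversing all products interchanges the two elementary rules, left and right swapping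
  words, and the two forms. Most arguments can thus be made for one side only.\<close>

fun mirror :: "'l bword \<Rightarrow> 'l bword" where
  "mirror (Letter a) = Letter a"
| "mirror (u \<cdot> v) = mirror v \<cdot> mirror u"

lemma mirror_mirror [simp]: "mirror (mirror u) = u"
  by (induction u) auto

lemma letters_mirror [simp]: "letters (mirror u) = rev (letters u)"
  by (induction u) auto

lemma len_mirror [simp]: "len (mirror u) = len u"
  by (simp add: len_def)

lemma mirror_eq_Letter [simp]: "mirror u = Letter a \<longleftrightarrow> u = Letter a"
  by (cases u) auto

lemma swapping_mirror [simp]:
  "left_swapping (mirror u) \<longleftrightarrow> right_swapping u"
  "right_swapping (mirror u) \<longleftrightarrow> left_swapping u"
  by (induction u) auto

lemma inner_mirror [simp]: "innerL (mirror u) = innerR u" "innerR (mirror u) = innerL u"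
  by (induction u) auto

lemma outer_mirror [simp]: "outerL (mirror u) = outerR u" "outerR (mirror u) = outerL u"
  by (induction u) auto

lemma weq_mirror: "u \<approx> v \<Longrightarrow> mirror u \<approx> mirror v"
  by (erule weq_transfer) (auto intro: weq_swapL weq_swapR weq_cong)

lemma subwords_mirror: "p \<in> subwords (mirror w) \<longleftrightarrow> mirror p \<in> subwords w"
proof (induction w)
  case (Letter a)
  then show ?case by (cases p) auto
next
  case (Prod u v)
  moreover have "p = mirror v \<cdot> mirror u \<longleftrightarrow> mirror p = u \<cdot> v"
    by (metis mirror.simps(2) mirror_mirror)
  ultimately show ?case by auto
qed

lemma swappable_mirror_imp: "swappable w s t \<Longrightarrow> swappable (mirror w) s t"
proof -
  assume "swappable w s t"
  then obtain w' v where w': "w \<approx> w'"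
    "(Letter t \<cdot> v) \<cdot> Letter s \<in> subwords w' \<or> Letter s \<cdot> (v \<cdot> Letter t) \<in> subwords w'"
    unfolding swappable_iff by blast
  have "Letter s \<cdot> (mirror v \<cdot> Letter t) \<in> subwords (mirror w') \<or>
        (Letter t \<cdot> mirror v) \<cdot> Letter s \<in> subwords (mirror w')"
    using w'(2) by (simp add: subwords_mirror)
  then show ?thesis
    unfolding swappable_iff using weq_mirror[OF w'(1)] by blast
qed

lemma swappable_mirror: "swappable (mirror w) = swappable w"
  using swappable_mirror_imp[of w] swappable_mirror_imp[of "mirror w"] by fastforce

lemma linked_mirror: "linked (mirror w) = linked w"
  by (simp add: linked_def fun_eq_iff swappable_mirror)

lemma swap_classes_mirror [simp]: "swap_classes (mirror w) = swap_classes w"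
  by (simp add: swap_classes_def swappable_mirror)

fun mirror_form :: "'l form \<Rightarrow> 'l form" where
  "mirror_form (FormL x y z) = FormR (mirror z) (mirror y) (mirror x)"
| "mirror_form (FormR z y x) = FormL (mirror x) (mirror y) (mirror z)"

abbreviation form_condition :: "length_case \<Rightarrow> 'l form \<Rightarrow> bool" where
  "form_condition K f \<equiv> length_condition K (len (fx f)) (len (fy f)) (len (fz f))"

lemma mirror_form_simps [simp]:
  "form_word (mirror_form f) = mirror (form_word f)"
  "swapping_form (mirror_form f) = swapping_form f"
  "len (fx (mirror_form f)) = len (fx f)"
  "len (fy (mirror_form f)) = len (fy f)"
  "len (fz (mirror_form f)) = len (fz f)"
  by (induction f) auto

text \<open>In case OO reflection exchanges the roles of \<open>u\<close> and \<open>v\<close> and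
  hence types I and II; the equality holds because types are collected in a set.\<close>

lemma letter_types_mirror: "letter_types K (mirror_form f) = letter_types K f"
  by (cases f; cases K) (auto simp: Let_def)


section \<open>Letters of swapping words\<close>

lemma swapping_letters:
  "left_swapping x \<Longrightarrow> set (letters x) = insert (innerL x) (outerL x)"
  "right_swapping x \<Longrightarrow> set (letters x) = insert (innerR x) (outerR x)"
  by (induction x rule: left_swapping_right_swapping.induct) auto

lemma swapping_inner_notin_outer:
  "left_swapping x \<Longrightarrow> distinct (letters x) \<Longrightarrow> innerL x \<notin> outerL x"
  "right_swapping x \<Longrightarrow> distinct (letters x) \<Longrightarrow> innerR x \<notin> outerR x"
  by (induction x rule: left_swapping_right_swapping.induct)
    (auto simp: swapping_letters)

lemma card_outerL: "left_swapping x \<Longrightarrow> distinct (letters x) \<Longrightarrow> Suc (card (outerL x)) = len x"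
  using swapping_letters(1)[of x] swapping_inner_notin_outer(1)[of x]
  by (metis card_insert_disjoint distinct_card finite_insert List.finite_set len_def)

lemma card_outerR: "right_swapping x \<Longrightarrow> distinct (letters x) \<Longrightarrow> Suc (card (outerR x)) = len x"
  using card_outerL[of "mirror x"] by simp

lemma finite_outer [simp]: "left_swapping x \<Longrightarrow> finite (outerL x)" "right_swapping x \<Longrightarrow> finite (outerR x)"
  using swapping_letters by (metis finite_insert List.finite_set)+

text \<open>Two outer letters are removed at a time. The parity of the length is preserved, so odd
  words end in case \<open>letter\<close> and even ones in case \<open>pair\<close>.\<close>

lemma right_swapping_induct [consumes 1, case_names letter pair step]:
  assumes "right_swapping y"
    and "\<And>a. P (Letter a)"
    and "\<And>a b. P (Letter a \<cdot> Letter b)"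
    and "\<And>c y d. right_swapping y \<Longrightarrow> P y \<Longrightarrow> P ((Letter c \<cdot> y) \<cdot> Letter d)"
  shows "P y"
  using assms(1)
proof (induction "len y" arbitrary: y rule: less_induct)
  case less
  show ?case
  proof (cases y)
    case (Letter a)
    then show ?thesis by (simp add: assms(2))
  next
    case (Prod u v)
    then obtain d where v: "v = Letter d" "left_swapping u" using less.prems by auto
    show ?thesis
    proof (cases u)
      case (Letter a)
      then show ?thesis using Prod v by (simp add: assms(3))
    next
      case u: (Prod c y')
      then obtain a where "c = Letter a" "right_swapping y'" using v by auto
      then show ?thesis using Prod v u less.hyps[of y'] assms(4)[of y' a d] by simp
    qed
  qed
qed

text \<open>A newly added operator and the previous outermost one are of opposite sides, so their
  letters are the ends of a subword \<open>s(vt)\<close> or \<open>(tv)s\<close>. Together with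
  transitivity this links all outer letters.\<close>

lemma outer_linked:
  "left_swapping x \<Longrightarrow> distinct (letters x) \<Longrightarrow> linked_set x (outerL x)"
  "right_swapping x \<Longrightarrow> distinct (letters x) \<Longrightarrow> linked_set x (outerR x)"
proof (induction x rule: left_swapping_right_swapping.induct)
  case (2 u v)
  then obtain a where u: "u = Letter a" and v: "right_swapping v" by auto
  have "linked_set (u \<cdot> v) (insert a (outerR v))"
  proof (rule linked_set_insert)
    show "linked_set (u \<cdot> v) (outerR v)" using 2 by (intro linked_set_mulI2) auto
    show "\<exists>t\<in>outerR v. linked (u \<cdot> v) a t" if "outerR v \<noteq> {}"
      using v that u by (cases v) (auto intro: linked_endsR)
  qed (use 2 in simp)
  then show ?case using u by simp
next
  case (4 u v)
  then obtain a where v: "v = Letter a" and u: "left_swapping u" by auto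
  have "linked_set (u \<cdot> v) (insert a (outerL u))"
  proof (rule linked_set_insert)
    show "linked_set (u \<cdot> v) (outerL u)" using 4 by (intro linked_set_mulI1) auto
    show "\<exists>t\<in>outerL u. linked (u \<cdot> v) a t" if "outerL u \<noteq> {}"
      using v that u by (cases u) (auto intro: linked_sym[OF linked_endsL])
  qed (use 4 in simp)
  then show ?case using v by simp
qed auto

text \<open>The two outermost letters of the right factor become operators around the whole product,
  and \<open>A\<close> now multiplies the core \<open>y\<close>.\<close>

lemma weq_peel_right: "A \<cdot> ((c \<cdot> y) \<cdot> d) \<approx> d \<cdot> ((A \<cdot> y) \<cdot> c)"
  by (rule weq_trans[OF weq_swapR weq_mul_left[OF weq_swapL]])

text \<open>Peeling pairs of outer letters reduces an odd word \<open>y\<close> to its inner letter,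
  which together with \<open>a\<close> forms the pattern \<open>(aA)t\<close>.\<close>

lemma inner_right_odd_linked:
  "right_swapping y \<Longrightarrow> odd (len y) \<Longrightarrow> linked ((Letter a \<cdot> A) \<cdot> y) a (innerR y)"
proof (induction y rule: right_swapping_induct)
  case (step c y d)
  then have "linked (Letter d \<cdot> (((Letter a \<cdot> A) \<cdot> y) \<cdot> Letter c)) a (innerR y)"
    by (auto intro: linked_mulI2[OF linked_mulI1])
  then show ?case
    using linked_weq[OF weq_peel_right[of "Letter a \<cdot> A" "Letter c" y "Letter d"]] by simp
qed (auto intro: linked_endsL)

text \<open>Peeling stops at a pair \<open>ab\<close> with inner letter \<open>a\<close>. Swapping
  the outer factors then gives \<open>b(a(Bc))\<close>, where \<open>a\<close> and \<open>c\<close>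
  are swappable.\<close>

lemma inner_right_even_linked:
  "right_swapping y \<Longrightarrow> even (len y) \<Longrightarrow> linked ((B \<cdot> Letter c) \<cdot> y) c (innerR y)"
proof (induction y rule: right_swapping_induct)
  case (pair a b)
  have "(B \<cdot> Letter c) \<cdot> (Letter a \<cdot> Letter b) \<approx> Letter b \<cdot> (Letter a \<cdot> (B \<cdot> Letter c))"
    by (rule weq_swapR)
  moreover have "linked \<dots> c a"
    by (intro linked_mulI2 linked_sym[OF linked_endsR])
  ultimately show ?case by (simp add: linked_weq)
next
  case (step a y d)
  then have "linked (Letter d \<cdot> (((B \<cdot> Letter c) \<cdot> y) \<cdot> Letter a)) c (innerR y)"
    by (auto intro: linked_mulI2[OF linked_mulI1])
  then show ?case
    using linked_weq[OF weq_peel_right[of "B \<cdot> Letter c" "Letter a" y "Letter d"]] by simp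
qed auto

lemma inner_left_odd_linked:
  assumes "left_swapping x" "odd (len x)"
  shows "linked (x \<cdot> (A \<cdot> Letter a)) a (innerL x)"
  using inner_right_odd_linked[of "mirror x" a "mirror A"] assms
    linked_mirror[of "x \<cdot> (A \<cdot> Letter a)"] by simp

lemma inner_left_even_linked:
  assumes "left_swapping x" "even (len x)"
  shows "linked (x \<cdot> (Letter c \<cdot> B)) c (innerL x)"
  using inner_right_even_linked[of "mirror x" "mirror B" c] assms
    linked_mirror[of "x \<cdot> (Letter c \<cdot> B)"] by simp

lemma right_swapping_lastE:
  assumes "right_swapping y" "outerR y \<noteq> {}"
  obtains y' d where "y = y' \<cdot> Letter d" "left_swapping y'" "d \<in> outerR y"
  using assms by (cases y) auto

lemma left_swapping_firstE:
  assumes "left_swapping x" "outerL x \<noteq> {}"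
  obtains a x' where "x = Letter a \<cdot> x'" "right_swapping x'" "a \<in> outerL x"
  using assms by (cases x) auto

text \<open>Each auxiliary fact \<open>p_q\<close> joins the inner letter of \<open>p\<close> to the
  outer letters of \<open>q\<close>. The word is rearranged until \<open>p\<close> multiplies a word
  with an outer letter of \<open>q\<close> at the end that the parity of \<open>len p\<close> calls
  for.\<close>

lemma letter_types_linked_FormL:
  assumes "left_swapping x" "right_swapping y" "right_swapping z"
    and dist: "distinct (letters ((x \<cdot> y) \<cdot> z))"
    and K: "length_condition K (len x) (len y) (len z)"
    and T: "T \<in> letter_types K (FormL x y z)"
  shows "linked_set ((x \<cdot> y) \<cdot> z) T"
proof -
  let ?w = "(x \<cdot> y) \<cdot> z"
  have "linked_set x (outerL x)" "linked_set y (outerR y)" "linked_set z (outerR z)"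
    using dist assms(1-3) by (auto intro: outer_linked)
  note outer = linked_set_mulI1[OF linked_set_mulI1[OF this(1)], of y z]
    linked_set_mulI1[OF linked_set_mulI2[OF this(2)], of x z]
    linked_set_mulI2[OF this(3), of "x \<cdot> y"]
  have zyx: "?w \<approx> (z \<cdot> y) \<cdot> x" by (rule weq_swapL)
  have x_z: "linked_set ?w (insert (innerL x) (outerR z))"
    if "even (len x)" "odd (len z)"
  proof (rule linked_set_insert[OF dist outer(3)])
    assume "outerR z \<noteq> {}"
    then obtain z' d where z: "z = z' \<cdot> Letter d" "left_swapping z'"
      using right_swapping_lastE[OF assms(3)] by metis
    \<comment> \<open>As \<open>len z\<close> is odd, \<open>z'\<close> has even length and cannot
      be a single letter. The link goes through its first letter \<open>c\<close>, after
      \<open>z'\<close> has been brought next to \<open>x\<close>.\<close>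
    then have "outerL z' \<noteq> {}" using that(2) by (cases z') auto
    then obtain c z'' where c: "z' = Letter c \<cdot> z''" using left_swapping_firstE[OF z(2)] by metis
    have "?w \<approx> Letter d \<cdot> (z' \<cdot> (x \<cdot> y))" unfolding z by (rule weq_swapR)
    also have "\<dots> \<approx> Letter d \<cdot> (y \<cdot> (x \<cdot> z'))" by (intro weq_mul_left weq_swapR)
    finally have "linked ?w c (innerL x)"
      using inner_left_even_linked[OF assms(1) that(1), of c z''] c
      by (simp add: linked_weq linked_mulI2)
    then show "\<exists>t\<in>outerR z. linked ?w (innerL x) t"
      using z c by (auto intro: linked_sym)
  qed
  have y_x: "linked_set ?w (insert (innerR y) (outerL x))" if "odd (len y)"
  proof (rule linked_set_insert[OF dist outer(1)])
    assume "outerL x \<noteq> {}"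
    then obtain a x' where x: "x = Letter a \<cdot> x'" "a \<in> outerL x"
      using left_swapping_firstE[OF assms(1)] by metis
    have "linked ?w (innerR y) a"
      unfolding x(1) by (intro linked_sym[OF linked_mulI1] inner_right_odd_linked assms(2) that)
    then show "\<exists>t\<in>outerL x. linked ?w (innerR y) t" using x(2) by (rule bexI)
  qed
  have z_y: "linked_set ?w (insert (innerR z) (outerR y))" if "odd (len z)"
  proof (rule linked_set_insert[OF dist outer(2)])
    assume "outerR y \<noteq> {}"
    then obtain y' d where y: "y = y' \<cdot> Letter d" "d \<in> outerR y"
      using right_swapping_lastE[OF assms(2)] by metis
    have "?w \<approx> (Letter d \<cdot> (y' \<cdot> x)) \<cdot> z"
      unfolding y(1) by (intro weq_mul_right weq_swapR)
    then have "linked ?w d (innerR z)"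
      using inner_right_odd_linked[OF assms(3) that] by (simp add: linked_weq)
    then show "\<exists>t\<in>outerR y. linked ?w (innerR z) t" using y(2) by (blast intro: linked_sym)
  qed
  have x_y: "linked_set ?w (insert (innerL x) (outerR y))" if "odd (len x)"
  proof (rule linked_set_insert[OF dist outer(2)])
    assume "outerR y \<noteq> {}"
    then obtain y' d where y: "y = y' \<cdot> Letter d" "d \<in> outerR y"
      using right_swapping_lastE[OF assms(2)] by metis
    have "linked ?w (innerL x) d"
      unfolding y(1) by (intro linked_sym[OF linked_mulI1] inner_left_odd_linked assms(1) that)
    then show "\<exists>t\<in>outerR y. linked ?w (innerL x) t" using y(2) by (rule bexI)
  qed
  have y_z: "linked_set ?w (insert (innerR y) (outerR z))" if "even (len y)"
  proof (rule linked_set_insert[OF dist outer(3)])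
    assume "outerR z \<noteq> {}"
    then obtain z' d where z: "z = z' \<cdot> Letter d" "d \<in> outerR z"
      using right_swapping_lastE[OF assms(3)] by metis
    have "linked ((z \<cdot> y) \<cdot> x) d (innerR y)"
      unfolding z(1) by (intro linked_mulI1 inner_right_even_linked assms(2) that)
    then have "linked ?w d (innerR y)" using linked_weq[OF zyx] by blast
    then show "\<exists>t\<in>outerR z. linked ?w (innerR y) t" using z(2) by (blast intro: linked_sym)
  qed
  have z_x: "linked_set ?w (insert (innerR z) (outerL x))" if "even (len z)"
  proof (rule linked_set_insert[OF dist outer(1)])
    assume "outerL x \<noteq> {}"
    then obtain a x' where x: "x = Letter a \<cdot> x'" "a \<in> outerL x"
      using left_swapping_firstE[OF assms(1)] by metis
    have "?w \<approx> ((y \<cdot> x') \<cdot> Letter a) \<cdot> z"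
      unfolding x(1) by (intro weq_mul_right weq_swapL)
    then have "linked ?w a (innerR z)"
      using inner_right_even_linked[OF assms(3) that] by (simp add: linked_weq)
    then show "\<exists>t\<in>outerL x. linked ?w (innerR z) t" using x(2) by (blast intro: linked_sym)
  qed
  show ?thesis
  proof (cases K)
    case Case_EOO
    then show ?thesis using K T x_z y_x z_y by auto
  next
    case Case_OEE
    then show ?thesis using K T x_y y_z z_x by auto
  next
    case Case_O11
    then have "outerR y = {}" "outerR z = {}" using K by (auto simp: len_1_iff)
    then show ?thesis using Case_O11 K T y_x by (auto simp: linked_set_def linked_def)
  next
    case Case_OO
    then obtain a where a: "x = Letter a" using K by (auto simp: len_1_iff)
    have "linked_set ?w (insert (innerR z) (outerL (x \<cdot> y)))"
    proof (rule linked_set_insert[OF dist])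
      show "linked_set ?w (outerL (x \<cdot> y))"
        using a assms(2) dist by (intro linked_set_mulI1 outer_linked) auto
      \<comment> \<open>Here \<open>x\<close> is the letter \<open>a\<close>, an outer letter of the
        left swapping word \<open>xy\<close>, and \<open>z\<close> is odd.\<close>
      have "linked ?w (innerR z) a"
        using inner_right_odd_linked[OF assms(3), of a y] K Case_OO a by (auto intro: linked_sym)
      then show "\<exists>t\<in>outerL (x \<cdot> y). linked ?w (innerR z) t" using a by auto
    qed
    moreover have "linked_set ?w (insert (innerL (x \<cdot> y)) (outerR z))"
      using y_z K Case_OO by simp
    ultimately show ?thesis using T Case_OO by (auto simp: Let_def)
  next
    case Case_OE
    then obtain b where b: "z = Letter b" using K by (auto simp: len_1_iff)
    have "outerR y \<noteq> {}" using K Case_OE assms(2) by (cases y) auto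
    then obtain y' d where y: "y = y' \<cdot> Letter d" "d \<in> outerR y"
      using right_swapping_lastE[OF assms(2)] by metis
    have "linked_set ?w (insert (innerL x) (outerL (z \<cdot> y)))"
    proof (rule linked_set_insert[OF dist])
      have "linked_set ((z \<cdot> y) \<cdot> x) (outerL (z \<cdot> y))"
        using b assms(2) dist by (intro linked_set_mulI1 outer_linked) auto
      then show "linked_set ?w (outerL (z \<cdot> y))" using linked_set_weq[OF zyx] by simp
      have "linked ?w (innerL x) d"
        unfolding y(1) using K Case_OE assms(1)
        by (intro linked_mulI1 linked_sym[OF inner_left_odd_linked]) auto
      then show "\<exists>t\<in>outerL (z \<cdot> y). linked ?w (innerL x) t" using y(2) by auto
    qed
    moreover have "linked_set ?w (insert (innerL (z \<cdot> y)) (outerL x))"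
      using y_x K Case_OE by simp
    ultimately show ?thesis using T Case_OE by (auto simp: Let_def)
  qed
qed


section \<open>Letter types\<close>

text \<open>These claims concern only words, not the algebra, and are invariant under reflection, so
  it suffices to establish them for \<open>FormL\<close>.\<close>

definition form_facts :: "length_case \<Rightarrow> 'l form \<Rightarrow> bool" where
  "form_facts K f \<longleftrightarrow>
     partition_on (set (letters (form_word f))) (letter_types K f) \<and>
     (\<forall>T \<in> letter_types K f. \<exists>C \<in> swap_classes (form_word f). T \<subseteq> C) \<and>
     card (letter_types K f) \<le> 3 \<and>
     (\<exists>C \<in> swap_classes (form_word f). len (form_word f) div 3 + 1 \<le> card C)"

lemma form_facts_mirror: "form_facts K (mirror_form f) \<longleftrightarrow> form_facts K f"
  by (simp add: form_facts_def letter_types_mirror)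

lemma partition_on_pair:
  assumes "A \<noteq> {}" "B \<noteq> {}" "A \<inter> B = {}" "X = A \<union> B"
  shows "partition_on X {A, B}"
  using assms by (auto simp: partition_on_def disjoint_def)

lemma partition_on_triple:
  assumes "A \<noteq> {}" "B \<noteq> {}" "C \<noteq> {}" "A \<inter> B = {}" "A \<inter> C = {}" "B \<inter> C = {}" "X = A \<union> B \<union> C"
  shows "partition_on X {A, B, C}"
  using assms by (auto simp: partition_on_def disjoint_def)

text \<open>If all three numbers were at most the rounded-down mean, their sum would force each of
  them to equal it.\<close>

lemma div_3_less_part:
  fixes a b c :: nat
  assumes "\<not> (a = b \<and> b = c)"
  shows "(a + b + c) div 3 + 1 \<le> a \<or> (a + b + c) div 3 + 1 \<le> b \<or> (a + b + c) div 3 + 1 \<le> c"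
proof (rule ccontr)
  assume "\<not> ?thesis"
  moreover have "3 * ((a + b + c) div 3) \<le> a + b + c" by simp
  ultimately show False using assms by linarith
qed

text \<open>The bound on the largest class comes from the sizes of the types, which cannot all be
  equal. The exception is O11 with three single letters, where two types lie in one class.\<close>

lemma form_facts_FormL:
  assumes "swapping_form (FormL x y z)"
    and dist: "distinct (letters (form_word (FormL x y z)))"
    and K: "form_condition K (FormL x y z)"
  shows "form_facts K (FormL x y z)"
proof -
  let ?w = "(x \<cdot> y) \<cdot> z" and ?f = "FormL x y z"
  have x: "left_swapping x" and y: "right_swapping y" and z: "right_swapping z"
    using assms(1) by auto
  have dx: "distinct (letters x)" and dy: "distinct (letters y)" and dz: "distinct (letters z)"
    and disj: "set (letters x) \<inter> set (letters y) = {}" "set (letters x) \<inter> set (letters z) = {}"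
      "set (letters y) \<inter> set (letters z) = {}"
    using dist by auto
  note sets = swapping_letters(1)[OF x] swapping_letters(2)[OF y] swapping_letters(2)[OF z]
  note notin = swapping_inner_notin_outer(1)[OF x dx] swapping_inner_notin_outer(2)[OF y dy]
    swapping_inner_notin_outer(2)[OF z dz]
  note card_outer = card_outerL[OF x dx] card_outerR[OF y dy] card_outerR[OF z dz]
  have K': "length_condition K (len x) (len y) (len z)" using K by simp
  have part: "partition_on (set (letters ?w)) (letter_types K ?f)"
  proof (cases K)
    case Case_OO
    then obtain a where "x = Letter a" using K' by (auto simp: len_1_iff)
    then show ?thesis
      using Case_OO sets disj notin
      by (simp add: Let_def) (rule partition_on_pair, auto)
  next
    case Case_OE
    then obtain a where "z = Letter a" using K' by (auto simp: len_1_iff)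
    then show ?thesis
      using Case_OE sets disj notin
      by (simp add: Let_def) (rule partition_on_pair, auto)
  qed (use sets disj notin in \<open>simp, intro partition_on_triple; auto\<close>)+
  have classes: "\<exists>C \<in> swap_classes ?w. T \<subseteq> C" if T: "T \<in> letter_types K ?f" for T
  proof (rule linked_set_class)
    show "linked_set ?w T" using letter_types_linked_FormL[OF x y z _ K' T] dist by simp
    show "T \<noteq> {}" "T \<subseteq> set (letters ?w)" using partition_onD1[OF part] partition_onD3[OF part] T by auto
  qed (use dist in simp)
  have card: "card (letter_types K ?f) \<le> 3"
    by (cases K) (auto simp: Let_def card_insert_if)
  have large: "\<exists>C \<in> swap_classes ?w. len ?w div 3 + 1 \<le> card C"
    if "T \<in> letter_types K ?f" "len ?w div 3 + 1 \<le> card T" for T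
    using classes[OF that(1)] that(2) card_mono[OF finite_swap_classes(2)[of _ ?w]]
    by (meson le_trans)
  have fin: "finite (outerL x)" "finite (outerR y)" "finite (outerR z)" using x y z by auto
  have "\<exists>C \<in> swap_classes ?w. len ?w div 3 + 1 \<le> card C"
  proof (cases K)
    case Case_EOO
    let ?I = "insert (innerL x) (outerR z)" and ?II = "insert (innerR y) (outerL x)"
      and ?III = "insert (innerR z) (outerR y)"
    \<comment> \<open>The foreign inner letter makes up for the missing one, so a type is as large
      as the word supplying its outer letters.\<close>
    have cards: "card ?I = len z" "card ?II = len x" "card ?III = len y"
      using card_outer fin sets disj by (auto simp: card_insert_if)
    have "\<not> (len x = len y \<and> len y = len z)" using K' Case_EOO by auto
    from div_3_less_part[OF this]
    have "len ?w div 3 + 1 \<le> len x \<or> len ?w div 3 + 1 \<le> len y \<or> len ?w div 3 + 1 \<le> len z"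
      by simp
    then show ?thesis
      using large[of ?I] large[of ?II] large[of ?III] Case_EOO unfolding cards by auto
  next
    case Case_OEE
    let ?I = "insert (innerL x) (outerR y)" and ?II = "insert (innerR y) (outerR z)"
      and ?III = "insert (innerR z) (outerL x)"
    have cards: "card ?I = len y" "card ?II = len z" "card ?III = len x"
      using card_outer fin sets disj by (auto simp: card_insert_if)
    have "\<not> (len x = len y \<and> len y = len z)" using K' Case_OEE by auto
    from div_3_less_part[OF this]
    have "len ?w div 3 + 1 \<le> len x \<or> len ?w div 3 + 1 \<le> len y \<or> len ?w div 3 + 1 \<le> len z"
      by simp
    then show ?thesis
      using large[of ?I] large[of ?II] large[of ?III] Case_OEE unfolding cards by auto
  next
    case Case_O11
    show ?thesis
    proof (cases "len x = 1")
      case True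
      then obtain a b c where abc: "x = Letter a" "y = Letter b" "z = Letter c"
        using K' Case_O11 by (auto simp: len_1_iff)
      \<comment> \<open>All three types are singletons here, while a class of two letters is
        required; \<open>a\<close> and \<open>c\<close> are the ends of
        \<open>(ab)c\<close>.\<close>
      have "linked_set ?w {a, c}"
        using linked_endsL[of a y c] linked_sym[OF linked_endsL[of a y c]] abc
        by (auto simp: linked_set_def linked_def)
      then obtain C where C: "C \<in> swap_classes ?w" "{a, c} \<subseteq> C"
        using linked_set_class[of ?w "{a, c}"] dist abc by auto
      have "card {a, c} \<le> card C" using card_mono[OF finite_swap_classes(2)[OF C(1)] C(2)] .
      then show ?thesis using C(1) dist abc by auto
    next
      case False
      let ?II = "insert (innerR y) (outerL x)"
      have cards: "card ?II = len x"
        using card_outer fin sets disj by (auto simp: card_insert_if)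
      have "len ?w div 3 + 1 \<le> len x"
        using div_3_less_part[of "len x" "len y" "len z"] K' Case_O11 False by auto
      then show ?thesis using large[of ?II] Case_O11 unfolding cards by auto
    qed
  next
    case Case_OO
    then obtain a where a: "x = Letter a" using K' by (auto simp: len_1_iff)
    let ?I = "insert (innerR z) (outerL (x \<cdot> y))" and ?II = "insert (innerL (x \<cdot> y)) (outerR z)"
    have cards: "card ?I = len x + len y" "card ?II = len z"
      using a card_outer fin sets disj by (auto simp: card_insert_if)
    \<comment> \<open>With only two types, the third part is taken to be 0, which can neither equal
      the others nor be the large one.\<close>
    have "len ?w div 3 + 1 \<le> len x + len y \<or> len ?w div 3 + 1 \<le> len z"
      using div_3_less_part[of "len x + len y" "len z" 0] by simp
    then show ?thesis
      using large[of ?I] large[of ?II] Case_OO unfolding cards by (auto simp: Let_def)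
  next
    case Case_OE
    then obtain a where a: "z = Letter a" using K' by (auto simp: len_1_iff)
    let ?I = "insert (innerL x) (outerL (z \<cdot> y))" and ?II = "insert (innerL (z \<cdot> y)) (outerL x)"
    have cards: "card ?I = len z + len y" "card ?II = len x"
      using a card_outer fin sets disj by (auto simp: card_insert_if)
    have "len ?w div 3 + 1 \<le> len z + len y \<or> len ?w div 3 + 1 \<le> len x"
      using div_3_less_part[of "len z + len y" "len x" 0] by (simp add: ac_simps)
    then show ?thesis
      using large[of ?I] large[of ?II] Case_OE unfolding cards by (auto simp: Let_def)
  qed
  then show ?thesis using part classes card by (simp add: form_facts_def)
qed

lemma form_facts:
  assumes "swapping_form f" "distinct (letters (form_word f))" "form_condition K f"
  shows "form_facts K f"
proof (cases f)
  case (FormL x y z)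
  then show ?thesis using form_facts_FormL assms by metis
next
  case (FormR z y x)
  then have "mirror_form f = FormL (mirror x) (mirror y) (mirror z)" by simp
  then have "form_facts K (mirror_form f)"
    using form_facts_FormL[of "mirror x" "mirror y" "mirror z" K] assms
      mirror_form_simps[of f] by (metis distinct_rev letters_mirror)
  then show ?thesis by (simp add: form_facts_mirror)
qed

text \<open>Every class contains some letter, which lies in a type. Classes sharing a letter
  coincide, so choosing for each type a class \<open>g T\<close> around it already reaches all
  classes.\<close>

lemma card_swap_classes:
  assumes "distinct (letters (form_word f))" "form_facts K f"
  shows "card (swap_classes (form_word f)) \<le> 3"
proof -
  let ?w = "form_word f" and ?Ts = "letter_types K f"
  have part: "partition_on (set (letters ?w)) ?Ts" and card: "card ?Ts \<le> 3"
    using assms(2) by (auto simp: form_facts_def)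
  obtain g where g: "\<And>T. T \<in> ?Ts \<Longrightarrow> g T \<in> swap_classes ?w \<and> T \<subseteq> g T"
    using assms(2) unfolding form_facts_def by metis
  have fin: "finite ?Ts" using finite_elements[OF _ part] by simp
  have "swap_classes ?w \<subseteq> g ` ?Ts"
  proof
    fix C assume C: "C \<in> swap_classes ?w"
    then obtain s where s: "s \<in> C" using swap_classes_nonempty by blast
    then have "s \<in> set (letters ?w)" using C by (auto simp: swap_classes_def)
    then obtain T where T: "T \<in> ?Ts" "s \<in> T" using partition_onD1[OF part] by blast
    then have "s \<in> g T" using g by blast
    then have "C = g T"
      using swap_classes_eq[OF assms(1) C s] swap_classes_eq[OF assms(1), of "g T" s] g[OF T(1)]
      by simp
    then show "C \<in> g ` ?Ts" using T by simp
  qed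
  then have "card (swap_classes ?w) \<le> card (g ` ?Ts)"
    using fin by (intro card_mono) auto
  also have "\<dots> \<le> card ?Ts" by (rule card_image_le[OF fin])
  finally show ?thesis using card by simp
qed


section \<open>Reduction to the forms\<close>

text \<open>One round shortens \<open>y\<close> by its outer letters \<open>c\<close> and
  \<open>d\<close>: the word \<open>Z\<close> grows to the left swapping word \<open>s(Zd)\<close>,
  and \<open>c\<close> takes the place of \<open>s\<close>. The rounds end when one letter of
  \<open>y\<close> is left.\<close>

lemma move_right_to_left:
  assumes "right_swapping y" "odd (len y)" "left_swapping Z"
  shows "\<exists>Z' t v. left_swapping Z' \<and> len Z' + 1 = len Z + len y \<and>
           (Z \<cdot> Letter s) \<cdot> (A \<cdot> y) \<approx> (Z' \<cdot> Letter t) \<cdot> (A \<cdot> Letter v)"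
  using assms
proof (induction y arbitrary: Z s rule: right_swapping_induct)
  case (letter a)
  then show ?case using weq_refl by fastforce
next
  case (step c y d)
  let ?Z = "Letter s \<cdot> (Z \<cdot> Letter d)"
  have "(Z \<cdot> Letter s) \<cdot> (A \<cdot> ((Letter c \<cdot> y) \<cdot> Letter d))
      \<approx> (Z \<cdot> Letter s) \<cdot> (Letter d \<cdot> ((A \<cdot> y) \<cdot> Letter c))"
    by (rule weq_mul_left[OF weq_peel_right])
  also have "\<dots> \<approx> ((A \<cdot> y) \<cdot> Letter c) \<cdot> (Letter d \<cdot> (Z \<cdot> Letter s))" by (rule weq_swapR)
  also have "\<dots> \<approx> ((A \<cdot> y) \<cdot> Letter c) \<cdot> ?Z" by (rule weq_mul_left[OF weq_swapR])
  also have "\<dots> \<approx> (?Z \<cdot> Letter c) \<cdot> (A \<cdot> y)" by (rule weq_swapL)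
  finally have *: "(Z \<cdot> Letter s) \<cdot> (A \<cdot> ((Letter c \<cdot> y) \<cdot> Letter d)) \<approx> (?Z \<cdot> Letter c) \<cdot> (A \<cdot> y)" .
  obtain Z' t v where "left_swapping Z'" "len Z' + 1 = len ?Z + len y"
    "(?Z \<cdot> Letter c) \<cdot> (A \<cdot> y) \<approx> (Z' \<cdot> Letter t) \<cdot> (A \<cdot> Letter v)"
    using step.IH[of ?Z c] step.prems by auto
  then show ?case using weq_trans[OF *] by (intro exI[of _ Z'] exI[of _ t] exI[of _ v]) simp
qed simp

definition reducible :: "'l bword \<Rightarrow> bool" where
  "reducible w \<longleftrightarrow> (\<exists>f K. swapping_form f \<and> form_condition K f \<and> w \<approx> form_word f)"

lemma reducibleI: "w \<approx> form_word f \<Longrightarrow> swapping_form f \<Longrightarrow> form_condition K f \<Longrightarrow> reducible w"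
  unfolding reducible_def by blast

lemma reducible_mirror: "reducible w \<Longrightarrow> reducible (mirror w)"
  unfolding reducible_def by (metis mirror_form_simps weq_mirror)

text \<open>The facts \<open>L\<close> and \<open>R\<close> give new forms with the factors permuted
  and one of them lengthened by \<open>s\<close>. They settle EOO and OEE on both sides, and left
  multiplication in O11 and OE.\<close>

lemma reducible_mul_FormL:
  assumes "swapping_form (FormL x y z)" "form_condition K (FormL x y z)"
  shows "reducible (Letter s \<cdot> ((x \<cdot> y) \<cdot> z)) \<and> reducible (((x \<cdot> y) \<cdot> z) \<cdot> Letter s)"
proof -
  have x: "left_swapping x" and y: "right_swapping y" and z: "right_swapping z"
    and K: "length_condition K (len x) (len y) (len z)"
    using assms by auto
  have "Letter s \<cdot> ((x \<cdot> y) \<cdot> z) \<approx> z \<cdot> ((x \<cdot> y) \<cdot> Letter s)" by (rule weq_swapR)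
  also have "\<dots> \<approx> z \<cdot> ((Letter s \<cdot> y) \<cdot> x)" by (rule weq_mul_left[OF weq_swapL])
  also have "\<dots> \<approx> x \<cdot> ((Letter s \<cdot> y) \<cdot> z)" by (rule weq_swapR)
  finally have L: "Letter s \<cdot> ((x \<cdot> y) \<cdot> z) \<approx> form_word (FormR x (Letter s \<cdot> y) z)" by simp
  have R: "((x \<cdot> y) \<cdot> z) \<cdot> Letter s \<approx> form_word (FormR (Letter s \<cdot> z) x y)"
    by (simp add: weq_swapL)
  \<comment> \<open>Fact \<open>R\<close> would give lengths odd, odd, even, which is none of the
    cases. Emptying \<open>y\<close> into \<open>sz\<close> gives \<open>v(x(Zt))\<close> with
    \<open>Zt\<close> of even length, which is EOO.\<close>
  have one: "reducible (((x \<cdot> y) \<cdot> z) \<cdot> Letter s)" if odd: "odd (len x)" "odd (len y)" "len z = 1"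
  proof -
    obtain c where c: "z = Letter c" using odd(3) by (auto simp: len_1_iff)
    obtain Z t v where Z: "left_swapping Z" "len Z + 1 = len (Letter s) + len y"
      "(Letter s \<cdot> Letter c) \<cdot> (x \<cdot> y) \<approx> (Z \<cdot> Letter t) \<cdot> (x \<cdot> Letter v)"
      using move_right_to_left[OF y odd(2), of "Letter s" c x] by auto
    have "((x \<cdot> y) \<cdot> z) \<cdot> Letter s \<approx> (Letter s \<cdot> Letter c) \<cdot> (x \<cdot> y)"
      unfolding c by (rule weq_swapL)
    also have "\<dots> \<approx> (Z \<cdot> Letter t) \<cdot> (x \<cdot> Letter v)" by (rule Z(3))
    also have "\<dots> \<approx> form_word (FormR (Letter v) x (Z \<cdot> Letter t))"
      by (simp add: weq_swapR)
    finally show ?thesis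
      by (rule reducibleI[where K = Case_EOO]) (use x Z odd in auto)
  qed
  have two: "reducible (Letter s \<cdot> ((x \<cdot> y) \<cdot> z))" if "odd (len x)" "odd (len y)" "len z = 1"
    using reducibleI[OF L, of Case_OO] x y z that by simp
  show ?thesis
  proof (cases K)
    case Case_EOO
    then show ?thesis
      using reducibleI[OF L, of Case_OEE] reducibleI[OF R, of Case_OEE] x y z K by simp
  next
    case Case_OEE
    then show ?thesis
      using reducibleI[OF L, of Case_EOO] reducibleI[OF R, of Case_EOO] x y z K by simp
  next
    case Case_O11
    then show ?thesis using one two K by simp
  next
    case Case_OE
    then show ?thesis using one two K by simp
  next
    case Case_OO
    then obtain a where a: "x = Letter a" using K by (auto simp: len_1_iff)
    have "even (len y)" using K Case_OO by simp
    \<comment> \<open>In case OO the word \<open>xy\<close> is itself left swapping, so both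
      products are forms without any rewriting. The bound makes \<open>len (xy)\<close> at least 3,
      as OE demands.\<close>
    then have "2 \<le> len y" using len_pos[of y] by presburger
    then have "reducible (Letter s \<cdot> ((x \<cdot> y) \<cdot> z))"
      using reducibleI[of _ "FormR (Letter s) (x \<cdot> y) z" Case_OE] x y z K Case_OO a by auto
    moreover have "reducible (((x \<cdot> y) \<cdot> z) \<cdot> Letter s)"
    proof (cases "len z = 1")
      case True
      then show ?thesis
        using reducibleI[of _ "FormL (x \<cdot> y) z (Letter s)" Case_O11] x y z K Case_OO a by auto
    next
      case False
      then have "3 \<le> len z" using K Case_OO by simp presburger
      then show ?thesis
        using reducibleI[of _ "FormL (x \<cdot> y) z (Letter s)" Case_OE] x y z K Case_OO a by auto
    qed
    ultimately show ?thesis ..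
  qed
qed

lemma reducible_mul:
  assumes "reducible w"
  shows "reducible (Letter s \<cdot> w) \<and> reducible (w \<cdot> Letter s)"
proof -
  obtain f K where f: "swapping_form f" "form_condition K f" "w \<approx> form_word f"
    using assms unfolding reducible_def by blast
  have "reducible (Letter s \<cdot> form_word f) \<and> reducible (form_word f \<cdot> Letter s)"
  proof (cases f)
    case (FormL x y z)
    then show ?thesis using reducible_mul_FormL f by fastforce
  next
    case (FormR z y x)
    let ?v = "(mirror x \<cdot> mirror y) \<cdot> mirror z"
    have "reducible (Letter s \<cdot> ?v) \<and> reducible (?v \<cdot> Letter s)"
      using f FormR by (intro reducible_mul_FormL[where K = K]) auto
    then show ?thesis
      using reducible_mirror[of "Letter s \<cdot> ?v"] reducible_mirror[of "?v \<cdot> Letter s"] FormR by simp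
  qed
  moreover have "reducible v" if "reducible u" "v \<approx> u" for u v
    using that unfolding reducible_def by (metis weq_trans)
  ultimately show ?thesis using weq_mul_left[OF f(3)] weq_mul_right[OF f(3)] by blast
qed

lemma spow_reducible: "w \<in> spow S (Suc (Suc (Suc k))) \<Longrightarrow> reducible w"
proof (induction k arbitrary: w)
  case 0
  then obtain a b c where "w = (Letter a \<cdot> Letter b) \<cdot> Letter c \<or> w = Letter c \<cdot> (Letter a \<cdot> Letter b)"
    by auto
  then show ?case
    using reducibleI[of w "FormL (Letter a) (Letter b) (Letter c)" Case_O11]
      reducibleI[of w "FormR (Letter c) (Letter a) (Letter b)" Case_O11] by auto
next
  case (Suc k)
  then obtain u s where "u \<in> spow S (Suc (Suc (Suc k)))" "w = u \<cdot> Letter s \<or> w = Letter s \<cdot> u"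
    by (subst (asm) (3) spow.simps) blast
  then show ?case using Suc.IH reducible_mul by metis
qed

section \<open>Words over occurrences of letters\<close>

lemma letters_occ_from: "letters (occ_from k w) = [k..<k + len w]"
proof (induction w arbitrary: k)
  case (Prod u v)
  then show ?case using upt_add_eq_append[of k "k + len u" "len v"] by (simp add: add.assoc)
qed simp

lemma occ_from_spow: "w \<in> spow S m \<Longrightarrow> occ_from k w \<in> spow UNIV m"
  by (induction S m arbitrary: w k rule: spow.induct) auto

lemma len_spow: "w \<in> spow S m \<Longrightarrow> len w = m"
  by (induction S m arbitrary: w rule: spow.induct) auto

lemma letters_spow: "w \<in> spow S m \<Longrightarrow> set (letters w) \<subseteq> S"
  by (induction S m arbitrary: w rule: spow.induct) fastforce+

text \<open>The surrounding lists \<open>xs\<close> and \<open>ys\<close> are needed for the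
  induction: each factor of a product sees the letters of the other as context, and
  \<open>length xs\<close> is its offset.\<close>

lemma map_occ_from:
  "map_bword (\<lambda>i. (xs @ letters w @ ys) ! i) (occ_from (length xs) w) = w"
proof (induction w arbitrary: xs ys)
  case (Prod u v)
  show ?case using Prod(1)[of xs "letters v @ ys"] Prod(2)[of "xs @ letters u" ys]
    by (simp add: len_def)
qed (simp add: nth_append)

lemma map_occ: "map_bword (\<lambda>i. letters w ! i) (occ w) = w"
  using map_occ_from[of "[]" w "[]"] by simp


section \<open>Formal equivalence implies equivalence\<close>

context nonassoc_algebra
begin

lemma mul_add_left: "mul (x + y) z = mul x z + mul y z"
  and mul_add_right: "mul z (x + y) = mul z x + mul z y"
  using linear_mul_left[of z] linear_mul_right[of z]
  by (simp_all add: Vector_Spaces.linear_iff)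

lemma mul_scale_left: "mul (scale c x) z = scale c (mul x z)"
  and mul_scale_right: "mul z (scale c x) = scale c (mul z x)"
  using linear_mul_left[of z] linear_mul_right[of z]
  by (simp_all add: Vector_Spaces.linear_iff)

lemma mul_zero_left [simp]: "mul 0 z = 0" and mul_zero_right [simp]: "mul z 0 = 0"
  using mul_add_left[of 0 0 z] mul_add_right[of z 0 0] by simp_all

lemma word_spanI: "set (letters u) \<subseteq> S \<Longrightarrow> len u \<le> k \<Longrightarrow> val u \<in> word_span S k"
  unfolding word_span_def by (intro span_base) auto

lemma word_span_unities: "e \<in> unities \<Longrightarrow> e \<in> word_span S k"
  unfolding word_span_def by (intro span_base) auto

text \<open>The elements with both products in the target span form a subspace, so generators
  suffice. A unity, which is no word here, yields \<open>val z\<close> itself.\<close>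

lemma word_span_mul:
  assumes "x \<in> word_span S k" "set (letters z) \<subseteq> S"
  shows "mul x (val z) \<in> word_span S (k + len z) \<and> mul (val z) x \<in> word_span S (k + len z)"
proof -
  let ?W = "word_span S (k + len z)"
  let ?P = "{x. mul x (val z) \<in> ?W \<and> mul (val z) x \<in> ?W}"
  have "subspace ?P"
    unfolding word_span_def
    by (rule subspaceI)
      (auto simp: mul_add_left mul_add_right mul_scale_left mul_scale_right
        intro: span_add span_scale span_zero)
  moreover have "x \<in> ?P" if "x \<in> val ` {u. set (letters u) \<subseteq> S \<and> len u \<le> k} \<union> unities" for x
    using that
  proof
    assume "x \<in> val ` {u. set (letters u) \<subseteq> S \<and> len u \<le> k}"
    then obtain u where "x = val u" "set (letters u) \<subseteq> S" "len u \<le> k" by blast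
    then show ?thesis
      using word_spanI[of "u \<cdot> z" S "k + len z"] word_spanI[of "z \<cdot> u" S "k + len z"] assms(2)
      by auto
  next
    assume "x \<in> unities"
    then show ?thesis using word_spanI[OF assms(2), of "k + len z"] by (auto simp: unities_def)
  qed
  ultimately have "x \<in> ?P"
    using assms(1) unfolding word_span_def by (metis (no_types, lifting) span_minimal subsetD subsetI)
  then show ?thesis by simp
qed

text \<open>Each generator omits at least one of the three words, and every word has positive
  length; this accounts for the decrease by one.\<close>

lemma L2_span_subset_word_span:
  assumes "set (letters a) \<subseteq> S" "set (letters b) \<subseteq> S" "set (letters c) \<subseteq> S"
  shows "L2_span (val a) (val b) (val c) \<subseteq> word_span S (len a + len b + len c - 1)"
proof -
  let ?k = "len a + len b + len c - 1"
  have words: "val u \<in> word_span S ?k"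
    if "u \<in> {a, b, c, a \<cdot> b, b \<cdot> a, c \<cdot> b, b \<cdot> c, a \<cdot> c, c \<cdot> a}" for u
    using that assms len_pos[of a] len_pos[of b] len_pos[of c]
    by (intro word_spanI) (auto simp del: len_pos)
  have "{val a, val b, val c, mul (val a) (val b), mul (val b) (val a), mul (val c) (val b),
      mul (val b) (val c), mul (val a) (val c), mul (val c) (val a)} \<union> unities \<subseteq> word_span S ?k"
    using words word_span_unities by (auto simp flip: val.simps(2))
  then show ?thesis
    unfolding L2_span_def by (rule span_minimal) (simp add: word_span_def)
qed

end

context descendingly_flexible_algebra
begin

text \<open>A sum appears because the two sides carry opposite signs. Multiplication by
  \<open>z\<close> raises both the length and the degree of the remainder by
  \<open>len z\<close>.\<close>

lemma elementary_val:
  "elementary x y \<Longrightarrow> set (letters (unsigned x)) \<subseteq> S \<Longrightarrow>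
     val (unsigned x) + val (unsigned y) \<in> word_span S (len (unsigned x) - 1)"
proof (induction rule: elementary.induct)
  case (elem_left a b c)
  then have "mul (mul (val a) (val b)) (val c) + mul (mul (val c) (val b)) (val a)
      \<in> L2_span (val a) (val b) (val c)"
    using descendingly_flexible unfolding descendingly_flexible_def by blast
  then show ?case using L2_span_subset_word_span[of a S b c] elem_left by auto
next
  case (elem_right a b c)
  then have "mul (val a) (mul (val b) (val c)) + mul (val c) (mul (val b) (val a))
      \<in> L2_span (val a) (val b) (val c)"
    using descendingly_flexible unfolding descendingly_flexible_def by blast
  then show ?case using L2_span_subset_word_span[of a S b c] elem_right by (auto simp: add.assoc)
next
  case (elem_mul_right x y z)
  have "len (unsigned x) - 1 + len z = len (unsigned x \<cdot> z) - 1"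
    using len_pos[of "unsigned x"] by (simp del: len_pos)
  then show ?case
    using word_span_mul[of "val (unsigned x) + val (unsigned y)" S "len (unsigned x) - 1" z]
      elem_mul_right by (simp add: mul_add_left)
next
  case (elem_mul_left x y z)
  have "len (unsigned x) - 1 + len z = len (z \<cdot> unsigned x) - 1"
    using len_pos[of "unsigned x"] by (simp del: len_pos)
  then show ?case
    using word_span_mul[of "val (unsigned x) + val (unsigned y)" S "len (unsigned x) - 1" z]
      elem_mul_left by (simp add: mul_add_right)
qed

lemma elementary_equivalent:
  assumes "elementary (Pos u) (Neg v)" "set (letters u) \<subseteq> S"
  shows "equivalent S (Pos u) (Neg v)"
  using elementary_val[OF assms(1)] assms weq_len[OF weq_step[OF assms(1)]]
    weq_set[OF weq_step[OF assms(1)]]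
  by (simp add: equivalent_def)

text \<open>Each elementary step flips the sign; as \<open>\<approx>\<close> forgets the number of
  steps, both signs have to be allowed.\<close>

lemma weq_equivalent:
  assumes "u \<approx> v" "set (letters u) \<subseteq> S"
  shows "equivalent S (Pos u) (Pos v) \<or> equivalent S (Pos u) (Neg v)"
  using assms(1)
proof (induction rule: weq_induct)
  case refl
  then show ?case using assms(2) by (simp add: equivalent_def word_span_def span_zero)
next
  case (step v v')
  let ?W = "word_span S (len u - 1)"
  have uv: "len v = len u" "set (letters v) \<subseteq> S"
    using weq_len[OF step(1)] weq_set[OF step(1)] assms(2) by auto
  have eq: "equivalent S (Pos v) (Neg v')" by (rule elementary_equivalent[OF step(2) uv(2)])
  then have "val v + val v' \<in> word_span S (len v - 1)"
    unfolding equivalent_def sval.simps unsigned.simps diff_minus_eq_add by (elim conjE)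
  then have *: "val v + val v' \<in> ?W" by (simp only: uv(1))
  have "val u - val v' \<in> ?W" if "val u + val v \<in> ?W"
    using span_diff[OF that[unfolded word_span_def] *[unfolded word_span_def]]
    by (simp add: word_span_def algebra_simps)
  moreover have "val u + val v' \<in> ?W" if "val u - val v \<in> ?W"
    using span_add[OF that[unfolded word_span_def] *[unfolded word_span_def]]
    by (simp add: word_span_def algebra_simps)
  ultimately show ?case using step(3) eq by (auto simp: equivalent_def)
qed

lemma weq_represents:
  assumes "set (letters w) \<subseteq> S" "swapping_form f" "occ w \<approx> form_word f"
  shows "represents S w f"
proof -
  have "w \<approx> map_bword (\<lambda>i. letters w ! i) (form_word f)"
    using weq_map[OF assms(3), of "\<lambda>i. letters w ! i"] by (simp add: map_occ)
  then show ?thesis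
    using weq_equivalent[OF _ assms(1)] assms(2) weq_mset[OF assms(3)] swap_classes_weq[OF assms(3)]
    by (auto simp: represents_def Let_def)
qed

text \<open>The properties of \<open>u\<close> and \<open>v\<close> follow from the lengths and the
  shapes of the factors, and the extra equivalence in case OE is a single elementary one.\<close>

lemma form_condition_in_case:
  assumes "set (letters w) \<subseteq> S" "swapping_form f" "occ w \<approx> form_word f" "form_condition K f"
  shows "in_case S w K f"
proof -
  let ?g = "\<lambda>i. letters w ! i"
  have S: "set (letters (map_bword ?g (form_word f))) \<subseteq> S"
    using weq_set[OF weq_map[OF assms(3), of ?g]] assms(1) by (simp add: map_occ)
  have "case_properties S w K f"
  proof (cases K)
    case Case_OO
    then show ?thesis using assms(2,4) by (cases f) (auto simp: Let_def len_1_iff)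
  next
    case Case_OE
    show ?thesis
    proof (cases f)
      case (FormL x y z)
      have "equivalent S (Pos (map_bword ?g (form_word f))) (Neg (map_bword ?g ((z \<cdot> y) \<cdot> x)))"
        using FormL by (intro elementary_equivalent S) (simp add: elem_left)
      then show ?thesis using FormL assms(2,4) Case_OE by (auto simp: Let_def len_1_iff)
    next
      case (FormR z y x)
      have "equivalent S (Pos (map_bword ?g (form_word f))) (Neg (map_bword ?g (x \<cdot> (y \<cdot> z))))"
        using FormR by (intro elementary_equivalent S) (simp add: elem_right)
      then show ?thesis using FormR assms(2,4) Case_OE by (auto simp: Let_def len_1_iff)
    qed
  qed simp_all
  then show ?thesis using assms(4) by (simp add: in_case_def)
qed

end


theorem lemma5p2:
  fixes scale :: "'f::field \<Rightarrow> 'a::ab_group_add \<Rightarrow> 'a"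
    and mul :: "'a \<Rightarrow> 'a \<Rightarrow> 'a"
    and Basis :: "'a set"
    and S :: "'a set"
    and m :: nat
    and w :: "'a bword"
  assumes "descendingly_flexible_algebra scale mul"
    and "finite_dimensional_vector_space scale Basis"
    and "m \<ge> 3"
    and "w \<in> spow S m"
  shows "(\<exists>f K. nonassoc_algebra.represents scale mul S w f \<and>
                nonassoc_algebra.in_case scale mul S w K f) \<and>
         card (swap_classes (occ w)) \<le> 3 \<and>
         (\<forall>f K. nonassoc_algebra.represents scale mul S w f \<and>
                nonassoc_algebra.in_case scale mul S w K f \<longrightarrow>
                partition_on (set (letters (form_word f))) (letter_types K f) \<and>
                (\<forall>T \<in> letter_types K f. \<exists>C \<in> swap_classes (form_word f). T \<subseteq> C)) \<and>
         Max (card ` swap_classes (occ w)) \<ge> m div 3 + 1"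
proof -
  interpret descendingly_flexible_algebra scale mul by (rule assms(1))
  obtain k where m: "m = Suc (Suc (Suc k))"
    using assms(3) by (metis Suc_le_D numeral_3_eq_3 Suc_le_mono)
  have wS: "set (letters w) \<subseteq> S" and len: "len w = m"
    using letters_spow len_spow assms(4) by auto
  \<comment> \<open>The reduction is carried out on distinct labels, so that letters are tracked;
    the values in the algebra are put in afterwards.\<close>
  have "reducible (occ w)" using occ_from_spow[OF assms(4)] unfolding m by (rule spow_reducible)
  then obtain f K where f: "swapping_form f" "form_condition K f" "occ w \<approx> form_word f"
    unfolding reducible_def by blast
  \<comment> \<open>This is needed for every representing form, not just the constructed one.
    Distinctness comes from the multiset of labels alone.\<close>
  have types: "form_facts K' g \<and> distinct (letters (form_word g))"
    if "represents S w g" "in_case S w K' g" for g K'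
  proof -
    have "mset (letters (form_word g)) = mset (letters (occ w))"
      using that(1) by (simp add: represents_def)
    then have "distinct (letters (form_word g))"
      by (metis mset_eq_imp_distinct_iff letters_occ_from distinct_upt)
    then show ?thesis
      using that by (auto simp: represents_def in_case_def intro: form_facts)
  qed
  have rep: "represents S w f" and cas: "in_case S w K f"
    using weq_represents[OF wS f(1,3)] form_condition_in_case[OF wS f(1,3,2)] by auto
  have classes: "swap_classes (occ w) = swap_classes (form_word f)"
    by (rule swap_classes_weq[OF f(3)])
  have "len (form_word f) = m"
    using weq_len[OF f(3)] len by (simp add: len_def letters_occ_from)
  then obtain C where "C \<in> swap_classes (occ w)" "m div 3 + 1 \<le> card C"
    using types[OF rep cas] unfolding form_facts_def classes by auto
  then have "Max (card ` swap_classes (occ w)) \<ge> m div 3 + 1"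
    using finite_swap_classes(1) by (subst Max_ge_iff) auto
  moreover have "card (swap_classes (occ w)) \<le> 3"
    unfolding classes using types[OF rep cas] card_swap_classes by blast
  ultimately show ?thesis
    using rep cas types unfolding form_facts_def by blast
qed

end
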